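(* For all $n\ge1$ and $\mu\in\mathrm{WComp}_{n-1}$, $\dim\mathcal{L}ie(\mu)=|\mathsf{Lyn}_\mu|$.
   Context: Fix a field $\mathbf{k}$. $\mathrm{WComp}_{n-1}$: weak compositions (nonnegative integer sequences) with sum $n-1$. $\mathcal{L}ie(\mu)$ is the subspace of the multilinear component of the free Lie algebra on $[n]$ with compatible Lie brackets $[\cdot,\cdot]_j$, $j\in\mathbb{P}$ (relations: antisymmetry and Jacobi for each bracket, and $[x,[y,z]_j]_i+[z,[x,y]_j]_i+[y,[z,x]_j]_i+[x,[y,z]_i]_j+[z,[x,y]_i]_j+[y,[z,x]_i]_j=0$ for $i\ne j$) spanned by bracketed permutations of $[n]$ with exactly $\mu(j)$ brackets of type $j$. A labeled colored binary tree on $[n]$: planar rooted binary tree (internal node $x$ has left child $L(x)$, right child $R(x)$), leaves labeled bijectively by $[n]$, internal nodes colored by $\mathrm{color}(x)\in\mathbb{P}$. Valency $v(x)$: smallest leaf label in the subtree rooted at $x$. Normalized: $v(x)=v(L(x))$ for all internal $x$. An internal node $x$ is a Lyndon node if $L(x)$ is a leaf or $v(R(L(x)))>v(R(x))$. A colored Lyndon tree is a normalized such tree in which each non-Lyndon internal node $x$ has $\mathrm{color}(L(x))>\mathrm{color}(x)$. $\mathsf{Lyn}_\mu$: colored Lyndon trees on $[n]$ with exactly $\mu(j)$ internal nodes of color $j$ for each $j$. *)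

theory Defs
  imports "Jordan_Normal_Form.VS_Connect" "HOL-Algebra.AbelCoset" "HOL-Library.Poly_Mapping"
begin

section \<open>Colored binary trees\<close>

text \<open>Colors are positive integers; this is enforced by \<open>words\<close> below, not by the type.
  The same type serves for bracketed words: \<open>Node j s t\<close> is read as the bracket \<open>[s, t]\<^sub>j\<close>.\<close>

datatype ctree = Leaf nat | Node nat ctree ctree

primrec leaves :: "ctree \<Rightarrow> nat list" where
  "leaves (Leaf a) = [a]"
| "leaves (Node c l r) = leaves l @ leaves r"

primrec colors :: "ctree \<Rightarrow> nat list" where
  "colors (Leaf a) = []"
| "colors (Node c l r) = c # colors l @ colors r"

primrec subtrees :: "ctree \<Rightarrow> ctree set" where
  "subtrees (Leaf a) = {Leaf a}"
| "subtrees (Node c l r) = insert (Node c l r) (subtrees l \<union> subtrees r)"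

text \<open>A weak composition is a sequence indexed by the positive integers; the entry at index 0
  is fixed to be 0 so that \<open>WComp m\<close> contains each of them exactly once.\<close>

definition WComp :: "nat \<Rightarrow> (nat \<Rightarrow> nat) set" where
  "WComp m = {\<mu>. \<mu> 0 = 0 \<and> finite {j. \<mu> j \<noteq> 0} \<and> (\<Sum>j | \<mu> j \<noteq> 0. \<mu> j) = m}"

definition words :: "nat \<Rightarrow> ctree set" where
  "words n = {t. set (leaves t) \<subseteq> {1..n} \<and> (\<forall>j\<in>set (colors t). 1 \<le> j)}"

definition labeled_trees :: "nat \<Rightarrow> ctree set" where
  "labeled_trees n = {t \<in> words n. distinct (leaves t) \<and> set (leaves t) = {1..n}}"

definition labeled_trees_of_type :: "nat \<Rightarrow> (nat \<Rightarrow> nat) \<Rightarrow> ctree set" where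
  "labeled_trees_of_type n \<mu> = {t \<in> labeled_trees n. \<forall>j\<ge>1. count_list (colors t) j = \<mu> j}"


section \<open>Colored Lyndon trees\<close>

definition valency :: "ctree \<Rightarrow> nat" where
  "valency t = Min (set (leaves t))"

definition normalized :: "ctree \<Rightarrow> bool" where
  "normalized t \<longleftrightarrow> (\<forall>c l r. Node c l r \<in> subtrees t \<longrightarrow> valency (Node c l r) = valency l)"

text \<open>\<open>lyndon_node l r\<close>: the internal node with left child \<open>l\<close> and right child \<open>r\<close> is a
  Lyndon node.\<close>

fun lyndon_node :: "ctree \<Rightarrow> ctree \<Rightarrow> bool" where
  "lyndon_node (Leaf a) r \<longleftrightarrow> True"
| "lyndon_node (Node c' l' r') r \<longleftrightarrow> valency r' > valency r"

text \<open>The left child of a non-Lyndon node is always internal, hence the pattern below covers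
  every non-Lyndon node.\<close>

definition colored_lyndon :: "ctree \<Rightarrow> bool" where
  "colored_lyndon t \<longleftrightarrow> normalized t \<and>
    (\<forall>c c' l' r' r. Node c (Node c' l' r') r \<in> subtrees t \<longrightarrow>
        \<not> lyndon_node (Node c' l' r') r \<longrightarrow> c' > c)"

definition Lyn :: "nat \<Rightarrow> (nat \<Rightarrow> nat) \<Rightarrow> ctree set" where
  "Lyn n \<mu> = {t \<in> labeled_trees_of_type n \<mu>. colored_lyndon t}"


section \<open>Quotient modules\<close>

text \<open>The fields \<open>mult\<close> and \<open>one\<close> are irrelevant dummies: a module record extends a ring
  record.\<close>

definition quotient_module ::
  "('a, 'b, 'c) module_scheme \<Rightarrow> 'b set \<Rightarrow> ('a, 'b set) module" where
  "quotient_module M N =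
    \<lparr>carrier = a_rcosets\<^bsub>M\<^esub> N, mult = (\<lambda>_ _. N), one = N, zero = N,
     add = (\<lambda>A B. A <+>\<^bsub>M\<^esub> B),
     smult = (\<lambda>c A. \<Union>x\<in>A. N +>\<^bsub>M\<^esub> (c \<odot>\<^bsub>M\<^esub> x))\<rparr>"

lemma quotient_module_is_module:
  assumes M: "module R M" and N: "submodule R N M"
  shows "module R (quotient_module M N)"
proof -
  interpret Module.module R M by fact
  interpret N: LinearCombinations.submodule R N M by fact
  have neg: "\<ominus>\<^bsub>M\<^esub> x \<in> N" if "x \<in> N" for x
  proof -
    have "\<ominus>\<^bsub>M\<^esub> x = (\<ominus>\<^bsub>R\<^esub> \<one>\<^bsub>R\<^esub>) \<odot>\<^bsub>M\<^esub> x"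
      using that N.subset by (simp add: smult_l_minus subsetD)
    then show ?thesis using that by auto
  qed
  have sub: "additive_subgroup N M"
    by (rule additive_subgroupI, rule a_group[THEN group.subgroupI])
       (use N.subset N.zero_closed neg in \<open>auto simp flip: a_inv_def simp del: N.zero_closed\<close>)
  interpret S: abelian_subgroup N M
    by (rule abelian_subgroupI3[OF sub]) unfold_locales
  let ?Q = "quotient_module M N"
  have car: "A \<in> carrier ?Q \<longleftrightarrow> (\<exists>x\<in>carrier M. A = N +>\<^bsub>M\<^esub> x)" for A
    by (auto simp: quotient_module_def A_RCOSETS_def')
  have addc: "(N +>\<^bsub>M\<^esub> x) \<oplus>\<^bsub>?Q\<^esub> (N +>\<^bsub>M\<^esub> y) = N +>\<^bsub>M\<^esub> (x \<oplus>\<^bsub>M\<^esub> y)"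
    if "x \<in> carrier M" "y \<in> carrier M" for x y
    using S.a_rcos_sum[OF that] by (simp add: quotient_module_def)
  have smc: "c \<odot>\<^bsub>?Q\<^esub> (N +>\<^bsub>M\<^esub> x) = N +>\<^bsub>M\<^esub> (c \<odot>\<^bsub>M\<^esub> x)"
    if c: "c \<in> carrier R" and x: "x \<in> carrier M" for c x
  proof -
    have "N +>\<^bsub>M\<^esub> (c \<odot>\<^bsub>M\<^esub> y) = N +>\<^bsub>M\<^esub> (c \<odot>\<^bsub>M\<^esub> x)" if "y \<in> N +>\<^bsub>M\<^esub> x" for y
    proof -
      from that obtain h where h: "h \<in> N" "y = h \<oplus>\<^bsub>M\<^esub> x" by (auto simp: a_r_coset_def')
      then have hM: "h \<in> carrier M" using N.subset by auto
      have "c \<odot>\<^bsub>M\<^esub> y = c \<odot>\<^bsub>M\<^esub> h \<oplus>\<^bsub>M\<^esub> c \<odot>\<^bsub>M\<^esub> x"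
        using h hM c x by (simp add: smult_r_distr)
      then have "c \<odot>\<^bsub>M\<^esub> y \<in> N +>\<^bsub>M\<^esub> (c \<odot>\<^bsub>M\<^esub> x)"
        using h c by (auto simp: a_r_coset_def')
      then show ?thesis
        using S.a_repr_independence'[of "c \<odot>\<^bsub>M\<^esub> y" "c \<odot>\<^bsub>M\<^esub> x"] c x by simp
    qed
    moreover have "x \<in> N +>\<^bsub>M\<^esub> x" using S.a_rcos_self[OF x] .
    ultimately have "(\<Union>y\<in>N +>\<^bsub>M\<^esub> x. N +>\<^bsub>M\<^esub> (c \<odot>\<^bsub>M\<^esub> y)) = N +>\<^bsub>M\<^esub> (c \<odot>\<^bsub>M\<^esub> x)" by blast
    then show ?thesis by (simp add: quotient_module_def)
  qed
  have zero: "\<zero>\<^bsub>?Q\<^esub> = N +>\<^bsub>M\<^esub> \<zero>\<^bsub>M\<^esub>"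
    using N.subset by (simp add: quotient_module_def)
  show ?thesis
  proof (rule module_criteria, goal_cases)
    case 1 show ?case by (rule is_cring)
  next
    case 2 show ?case unfolding car zero by auto
  next
    case 3 show ?case unfolding car by (auto simp: addc)
  next
    case 4
    show ?case
    proof
      fix A assume "A \<in> carrier ?Q"
      then obtain x where x: "x \<in> carrier M" "A = N +>\<^bsub>M\<^esub> x" unfolding car by auto
      then have "A \<oplus>\<^bsub>?Q\<^esub> (N +>\<^bsub>M\<^esub> (\<ominus>\<^bsub>M\<^esub> x)) = \<zero>\<^bsub>?Q\<^esub>"
        by (simp add: addc zero r_neg)
      moreover have "N +>\<^bsub>M\<^esub> (\<ominus>\<^bsub>M\<^esub> x) \<in> carrier ?Q" unfolding car using x by auto
      ultimately show "\<exists>B\<in>carrier ?Q. A \<oplus>\<^bsub>?Q\<^esub> B = \<zero>\<^bsub>?Q\<^esub>" by blast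
    qed
  next
    case 5 show ?case unfolding car by (auto simp: smc)
  next
    case 6 show ?case unfolding car by (auto simp: addc M.a_comm)
  next
    case 7 show ?case unfolding car by (auto simp: addc M.a_assoc)
  next
    case 8 show ?case by (auto simp: car zero addc)
  next
    case 9 show ?case unfolding car by (auto simp: smc smult_assoc1)
  next
    case 10 show ?case by (auto simp: car smc)
  next
    case 11 show ?case unfolding car by (auto simp: smc addc smult_l_distr)
  next
    case 12 show ?case unfolding car by (auto simp: smc addc smult_r_distr)
  qed
qed


section \<open>The free algebra with compatible Lie brackets\<close>

definition scal :: "'k::field \<Rightarrow> (ctree \<Rightarrow>\<^sub>0 'k) \<Rightarrow> (ctree \<Rightarrow>\<^sub>0 'k)" where
  "scal c p = Poly_Mapping.map ((*) c) p"

text \<open>The free nonassociative algebra on \<open>[n]\<close> with one bilinear operation for each color: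
  formal linear combinations of bracketed words over \<open>[n]\<close>.\<close>

definition magma_algebra :: "nat \<Rightarrow> ('k::field, ctree \<Rightarrow>\<^sub>0 'k) module" where
  "magma_algebra n =
    \<lparr>carrier = {p. Poly_Mapping.keys p \<subseteq> words n}, mult = (\<lambda>_ _. 0), one = 0, zero = 0,
     add = (+), smult = scal\<rparr>"

definition bracket :: "nat \<Rightarrow> (ctree \<Rightarrow>\<^sub>0 'k) \<Rightarrow> (ctree \<Rightarrow>\<^sub>0 'k) \<Rightarrow> (ctree \<Rightarrow>\<^sub>0 'k::field)" where
  "bracket j p q = (\<Sum>s\<in>Poly_Mapping.keys p. \<Sum>t\<in>Poly_Mapping.keys q.
     Poly_Mapping.single (Node j s t) (Poly_Mapping.lookup p s * Poly_Mapping.lookup q t))"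

text \<open>The two-sided ideal generated by antisymmetry and the Jacobi identity for each bracket
  and by the mixed Jacobi identity for each pair of distinct brackets.\<close>

inductive_set lie_ideal :: "nat \<Rightarrow> (ctree \<Rightarrow>\<^sub>0 'k::field) set" for n where
  antisymmetry: "\<lbrakk>1 \<le> j; x \<in> carrier (magma_algebra n); y \<in> carrier (magma_algebra n)\<rbrakk> \<Longrightarrow>
    bracket j x y + bracket j y x \<in> lie_ideal n"
| jacobi: "\<lbrakk>1 \<le> j; x \<in> carrier (magma_algebra n); y \<in> carrier (magma_algebra n);
      z \<in> carrier (magma_algebra n)\<rbrakk> \<Longrightarrow>
    bracket j x (bracket j y z) + bracket j z (bracket j x y) + bracket j y (bracket j z x)
      \<in> lie_ideal n"
| mixed_jacobi: "\<lbrakk>1 \<le> i; 1 \<le> j; i \<noteq> j; x \<in> carrier (magma_algebra n);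
      y \<in> carrier (magma_algebra n); z \<in> carrier (magma_algebra n)\<rbrakk> \<Longrightarrow>
    bracket i x (bracket j y z) + bracket i z (bracket j x y) + bracket i y (bracket j z x) +
    bracket j x (bracket i y z) + bracket j z (bracket i x y) + bracket j y (bracket i z x)
      \<in> lie_ideal n"
| zero: "0 \<in> lie_ideal n"
| add: "\<lbrakk>p \<in> lie_ideal n; q \<in> lie_ideal n\<rbrakk> \<Longrightarrow> p + q \<in> lie_ideal n"
| scal: "p \<in> lie_ideal n \<Longrightarrow> scal c p \<in> lie_ideal n"
| bracket_left: "\<lbrakk>1 \<le> j; x \<in> carrier (magma_algebra n); p \<in> lie_ideal n\<rbrakk> \<Longrightarrow>
    bracket j x p \<in> lie_ideal n"
| bracket_right: "\<lbrakk>1 \<le> j; x \<in> carrier (magma_algebra n); p \<in> lie_ideal n\<rbrakk> \<Longrightarrow>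
    bracket j p x \<in> lie_ideal n"

definition free_lie :: "nat \<Rightarrow> ('k::field, (ctree \<Rightarrow>\<^sub>0 'k) set) module" where
  "free_lie n = quotient_module (magma_algebra n) (lie_ideal n)"

definition lie_class :: "nat \<Rightarrow> (ctree \<Rightarrow>\<^sub>0 'k::field) \<Rightarrow> (ctree \<Rightarrow>\<^sub>0 'k) set" where
  "lie_class n p = lie_ideal n +>\<^bsub>magma_algebra n\<^esub> p"

definition lie_bracket ::
  "nat \<Rightarrow> nat \<Rightarrow> (ctree \<Rightarrow>\<^sub>0 'k) set \<Rightarrow> (ctree \<Rightarrow>\<^sub>0 'k) set \<Rightarrow> (ctree \<Rightarrow>\<^sub>0 'k::field) set" where
  "lie_bracket n j A B = (\<Union>p\<in>A. \<Union>q\<in>B. lie_class n (bracket j p q))"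

text \<open>The element of the free algebra obtained by evaluating a bracketed word.\<close>

primrec lie_word :: "nat \<Rightarrow> ctree \<Rightarrow> (ctree \<Rightarrow>\<^sub>0 'k::field) set" where
  "lie_word n (Leaf a) = lie_class n (Poly_Mapping.single (Leaf a) 1)"
| "lie_word n (Node j s t) = lie_bracket n j (lie_word n s) (lie_word n t)"

text \<open>The subspace spanned by the bracketed permutations of \<open>[n]\<close> with exactly \<open>\<mu> j\<close> brackets
  of type \<open>j\<close>, as a vector space.\<close>

definition Lie :: "nat \<Rightarrow> (nat \<Rightarrow> nat) \<Rightarrow> ('k::field, (ctree \<Rightarrow>\<^sub>0 'k) set) module" where
  "Lie n \<mu> = (free_lie n)\<lparr>carrier :=
     LinearCombinations.module.span class_ring (free_lie n)
       (lie_word n ` labeled_trees_of_type n \<mu>)\<rparr>"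


subsection \<open>Well-formedness\<close>

lemma lookup_scal [simp]: "Poly_Mapping.lookup (scal c p) t = c * Poly_Mapping.lookup p t"
  by (simp add: scal_def Poly_Mapping.map.rep_eq when_def)

lemma magma_algebra_simps [simp]:
  "p \<in> carrier (magma_algebra n) \<longleftrightarrow> Poly_Mapping.keys p \<subseteq> words n"
  "\<zero>\<^bsub>magma_algebra n\<^esub> = 0"
  "p \<oplus>\<^bsub>magma_algebra n\<^esub> q = p + q"
  "c \<odot>\<^bsub>magma_algebra n\<^esub> p = scal c p"
  by (auto simp: magma_algebra_def)

lemma keys_scal: "Poly_Mapping.keys (scal c p) \<subseteq> Poly_Mapping.keys p"
  by (auto simp: in_keys_iff)

lemma keys_uminus': "Poly_Mapping.keys (- p :: ctree \<Rightarrow>\<^sub>0 'k::field) = Poly_Mapping.keys p"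
  by (auto simp: in_keys_iff)

lemma magma_algebra_add_closed:
  "\<lbrakk>p \<in> carrier (magma_algebra n); q \<in> carrier (magma_algebra n)\<rbrakk> \<Longrightarrow>
    p + q \<in> carrier (magma_algebra n)"
  using Poly_Mapping.keys_add[of p q] by auto

lemma magma_algebra_scal_closed:
  "p \<in> carrier (magma_algebra n) \<Longrightarrow> scal c p \<in> carrier (magma_algebra n)"
  using keys_scal[of c p] by auto

lemma magma_algebra_module:
  "module (class_ring :: 'k::field ring) (magma_algebra n :: ('k, _) module)"
proof (rule module_criteria, goal_cases)
  case 1 show ?case by (rule class_cring.is_cring)
next
  case 3 show ?case
    by (auto intro: magma_algebra_add_closed simp del: magma_algebra_simps(1))
next
  case 4
  have "- v \<in> carrier (magma_algebra n)" "v \<oplus>\<^bsub>magma_algebra n\<^esub> (- v) = \<zero>\<^bsub>magma_algebra n\<^esub>"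
    if "v \<in> carrier (magma_algebra n)" for v :: "ctree \<Rightarrow>\<^sub>0 'k"
    using that by (simp_all add: keys_uminus')
  then show ?case by blast
next
  case 5 show ?case
    by (auto intro: magma_algebra_scal_closed simp del: magma_algebra_simps(1))
qed (simp_all add: poly_mapping_eq_iff fun_eq_iff lookup_add algebra_simps)

lemma lookup_bracket:
  "Poly_Mapping.lookup (bracket j p q) u =
    (case u of Leaf _ \<Rightarrow> 0
     | Node i s t \<Rightarrow> if i = j then Poly_Mapping.lookup p s * Poly_Mapping.lookup q t else 0)"
proof (cases u)
  case (Node i s t)
  let ?f = "\<lambda>s t. Poly_Mapping.lookup p s * Poly_Mapping.lookup q t"
  have "Poly_Mapping.lookup (bracket j p q) u =
    (\<Sum>s'\<in>Poly_Mapping.keys p. \<Sum>t'\<in>Poly_Mapping.keys q.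
      if t' = t then (if s' = s then (if i = j then ?f s t else 0) else 0) else 0)"
    unfolding bracket_def lookup_sum
    by (intro sum.cong refl) (simp add: lookup_single when_def Node eq_commute)
  also have "\<dots> = (\<Sum>s'\<in>Poly_Mapping.keys p. if s' = s then (if i = j then ?f s t else 0) else 0)"
    by (intro sum.cong refl) (simp add: sum.delta in_keys_iff)
  also have "\<dots> = (if i = j then ?f s t else 0)"
    by (simp add: sum.delta in_keys_iff)
  finally show ?thesis by (simp add: Node)
qed (simp add: bracket_def lookup_sum lookup_single when_def)

lemma keys_bracket:
  "Poly_Mapping.keys (bracket j p q) \<subseteq>
     {Node j s t | s t. s \<in> Poly_Mapping.keys p \<and> t \<in> Poly_Mapping.keys q}"
  by (auto simp: in_keys_iff lookup_bracket split: ctree.splits if_splits)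

lemma bracket_closed:
  assumes "1 \<le> j" "p \<in> carrier (magma_algebra n)" "q \<in> carrier (magma_algebra n)"
  shows "bracket j p q \<in> carrier (magma_algebra n)"
proof -
  have "u \<in> words n" if u: "u \<in> Poly_Mapping.keys (bracket j p q)" for u
  proof -
    from u keys_bracket[of j p q] obtain s t where st: "u = Node j s t"
      "s \<in> Poly_Mapping.keys p" "t \<in> Poly_Mapping.keys q" by blast
    then have "s \<in> words n" "t \<in> words n" using assms by auto
    then show ?thesis using st(1) assms(1) by (auto simp: words_def)
  qed
  then show ?thesis by auto
qed

lemma lie_ideal_subset: "p \<in> lie_ideal n \<Longrightarrow> p \<in> carrier (magma_algebra n)"
proof (induction rule: lie_ideal.induct)
  case zero show ?case by simp
qed (intro magma_algebra_add_closed magma_algebra_scal_closed bracket_closed; assumption)+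

lemma lie_ideal_submodule:
  "submodule (class_ring :: 'k::field ring) (lie_ideal n) (magma_algebra n)"
proof (rule submodule.intro, goal_cases)
  case 1 show ?case by (rule magma_algebra_module)
next
  case 2 show ?case using lie_ideal_subset by blast
qed (auto intro: lie_ideal.intros)

lemma free_lie_vectorspace:
  "vectorspace (class_ring :: 'k::field ring) (free_lie n)"
  unfolding free_lie_def vectorspace_def
  using quotient_module_is_module[OF magma_algebra_module lie_ideal_submodule] class_field
  by blast

lemma bracket_add_left: "bracket j (p + p') q = bracket j p q + bracket j p' q"
  by (rule poly_mapping_eqI)
     (simp add: lookup_bracket lookup_add distrib_right split: ctree.split)

lemma bracket_add_right: "bracket j p (q + q') = bracket j p q + bracket j p q'"
  by (rule poly_mapping_eqI)
     (simp add: lookup_bracket lookup_add distrib_left split: ctree.split)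

lemma bracket_single:
  "bracket j (Poly_Mapping.single s a) (Poly_Mapping.single t b) =
    Poly_Mapping.single (Node j s t) (a * b)"
  by (rule poly_mapping_eqI)
     (auto simp: lookup_bracket lookup_single when_def split: ctree.split)

lemma mem_lie_class: "q \<in> lie_class n p \<longleftrightarrow> (\<exists>h\<in>lie_ideal n. q = h + p)"
  by (auto simp: lie_class_def a_r_coset_def')

lemma lie_class_add_ideal:
  assumes "h \<in> lie_ideal n"
  shows "lie_class n (h + p) = lie_class n p"
proof -
  have neg: "- h \<in> lie_ideal n"
    using lie_ideal.scal[OF assms, of "- 1"]
    by (metis (no_types, lifting) lookup_scal lookup_uminus mult_minus1 poly_mapping_eqI)
  show ?thesis
  proof (intro Set.set_eqI iffI)
    fix q assume "q \<in> lie_class n (h + p)"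
    then obtain k where "k \<in> lie_ideal n" "q = (k + h) + p"
      by (auto simp: mem_lie_class add.assoc)
    then show "q \<in> lie_class n p" using assms lie_ideal.add mem_lie_class by blast
  next
    fix q assume "q \<in> lie_class n p"
    then obtain k where "k \<in> lie_ideal n" "q = (k + - h) + (h + p)"
      by (auto simp: mem_lie_class)
    then show "q \<in> lie_class n (h + p)" using neg lie_ideal.add mem_lie_class by blast
  qed
qed

lemma lie_bracket_class:
  assumes "1 \<le> j" "p \<in> carrier (magma_algebra n)" "q \<in> carrier (magma_algebra n)"
  shows "lie_bracket n j (lie_class n p) (lie_class n q) = lie_class n (bracket j p q)"
proof -
  have "lie_class n (bracket j p' q') = lie_class n (bracket j p q)"
    if p': "p' \<in> lie_class n p" and q': "q' \<in> lie_class n q" for p' q'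
  proof -
    from p' q' obtain h k where hk: "h \<in> lie_ideal n" "k \<in> lie_ideal n" "p' = h + p" "q' = k + q"
      by (auto simp: mem_lie_class)
    have "bracket j p' q' = (bracket j h q' + bracket j p k) + bracket j p q"
      unfolding hk by (simp add: bracket_add_left bracket_add_right add_ac)
    moreover have "q' \<in> carrier (magma_algebra n)"
      using magma_algebra_add_closed[OF lie_ideal_subset assms(3)] hk by blast
    then have "bracket j h q' + bracket j p k \<in> lie_ideal n"
      using hk assms by (intro lie_ideal.add lie_ideal.bracket_left lie_ideal.bracket_right)
    ultimately show ?thesis by (simp add: lie_class_add_ideal)
  qed
  moreover have "p \<in> lie_class n p" "q \<in> lie_class n q"
    using lie_ideal.zero by (force simp: mem_lie_class)+
  ultimately show ?thesis unfolding lie_bracket_def by blast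
qed

lemma lie_word_eq_class:
  "t \<in> words n \<Longrightarrow> (lie_word n t :: (ctree \<Rightarrow>\<^sub>0 'k::field) set) =
     lie_class n (Poly_Mapping.single t 1)"
proof (induction t)
  case (Node j s t)
  then have "s \<in> words n" "t \<in> words n" "1 \<le> j" by (auto simp: words_def)
  with Node.IH show ?case
    by (simp add: lie_bracket_class bracket_single)
qed simp

end

theory Submission
  imports Defs
begin

text \<open>
  Read the (mixed) Jacobi identity for trees \<open>x\<close>, \<open>y\<close>, \<open>z\<close> with increasing valencies and colors
  \<open>j \<le> i\<close> as a rule that rewrites \<open>[[x, y]\<^sub>j, z]\<^sub>i\<close> into the other terms. On normalized trees
  the rules terminate, and the irreducible trees are exactly the colored Lyndon trees, which
  therefore span. For the independence one shows that the rewriting is confluent. The only overlap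
  that is not trivial is \<open>[[[p, q]\<^sub>a, y]\<^sub>b, z]\<^sub>c\<close> with \<open>a \<le> b \<le> c\<close>; it is resolved by the syzygy of
  the Leibniz identity \<open>[[x, y], z] = [x, [y, z]] + [[x, z], y]\<close> in four variables, polarized with
  respect to the colors. Finally, sending a tree to plus or minus its normalization, or to 0 if it
  repeats a label, maps the ideal of relations into the span of the rewriting rules, so that a linear
  combination of colored Lyndon trees in the ideal is its own normal form, which is 0.
\<close>

section \<open>Linear combinations of trees\<close>

abbreviation elt :: "ctree \<Rightarrow> ctree \<Rightarrow>\<^sub>0 'k::field" where
  "elt t \<equiv> Poly_Mapping.single t 1"

interpretation pm: Vector_Spaces.vector_space "scal :: 'k::field \<Rightarrow> _"
  by unfold_locales (simp_all add: poly_mapping_eq_iff fun_eq_iff lookup_add algebra_simps)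

lemma poly_mapping_eq_sum:
  "p = (\<Sum>t\<in>Poly_Mapping.keys p. scal (Poly_Mapping.lookup p t) (elt t))"
  by (rule poly_mapping_eqI)
     (simp add: lookup_sum lookup_single when_def sum.delta in_keys_iff if_distrib cong: if_cong)

lemma poly_mapping_linear_induct [case_names single add scal]:
  assumes "\<And>t. P (elt t)" and "\<And>p q. P p \<Longrightarrow> P q \<Longrightarrow> P (p + q)" and "\<And>c p. P p \<Longrightarrow> P (scal c p)"
  shows "P p"
proof -
  have "P (\<Sum>t\<in>A. scal (Poly_Mapping.lookup p t) (elt t))" if "finite A" for A
    using that
  proof (induction A)
    case empty
    show ?case using assms(3)[OF assms(1), of 0] by simp
  qed (use assms in auto)
  then show ?thesis by (subst poly_mapping_eq_sum) simp
qed

lemma bracket_scal_left: "bracket j (scal c p) q = scal c (bracket j p q)"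
  by (rule poly_mapping_eqI) (simp add: lookup_bracket split: ctree.split)

lemma bracket_scal_right: "bracket j p (scal c q) = scal c (bracket j p q)"
  by (rule poly_mapping_eqI) (simp add: lookup_bracket split: ctree.split)

lemma bracket_diff_left: "bracket j (p - p') q = bracket j p q - bracket j p' q"
  by (rule poly_mapping_eqI)
     (simp add: lookup_bracket lookup_minus left_diff_distrib split: ctree.split)

lemma bracket_diff_right: "bracket j p (q - q') = bracket j p q - bracket j p q'"
  by (rule poly_mapping_eqI)
     (simp add: lookup_bracket lookup_minus right_diff_distrib split: ctree.split)

lemmas bracket_linear = bracket_add_left bracket_add_right bracket_diff_left bracket_diff_right
  bracket_scal_left bracket_scal_right

text \<open>The outer color comes first.\<close>

definition jac :: "nat \<Rightarrow> nat \<Rightarrow> (ctree \<Rightarrow>\<^sub>0 'k) \<Rightarrow> (ctree \<Rightarrow>\<^sub>0 'k) \<Rightarrow> (ctree \<Rightarrow>\<^sub>0 'k)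
  \<Rightarrow> (ctree \<Rightarrow>\<^sub>0 'k::field)" where
  "jac i j x y z = bracket i (bracket j x y) z - bracket i x (bracket j y z)
    - bracket i (bracket j x z) y"

definition compat_rel :: "nat \<Rightarrow> nat \<Rightarrow> (ctree \<Rightarrow>\<^sub>0 'k) \<Rightarrow> (ctree \<Rightarrow>\<^sub>0 'k) \<Rightarrow> (ctree \<Rightarrow>\<^sub>0 'k)
  \<Rightarrow> (ctree \<Rightarrow>\<^sub>0 'k::field)" where
  "compat_rel i j x y z = (if i = j then jac i i x y z else jac i j x y z + jac j i x y z)"

lemma compat_rel_commute: "compat_rel i j x y z = compat_rel j i x y z"
  by (simp add: compat_rel_def add.commute)

text \<open>The syzygy of the Leibniz identity in four variables; \<open>k\<close> is the color of the bracket that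
  does not take part in the relation.\<close>

definition syzygy where
  "syzygy k i j p q y z =
     compat_rel i j (bracket k p q) y z - bracket k (compat_rel i j p q y) z
   + compat_rel i j p q (bracket k y z) + bracket k (compat_rel i j p q z) y
   + compat_rel i j p (bracket k q z) y - compat_rel i j p (bracket k q y) z
   - compat_rel i j (bracket k p y) q z + compat_rel i j (bracket k p z) q y
   - bracket k (compat_rel i j p y z) q - bracket k p (compat_rel i j q y z)"

text \<open>All bracketed words cancel in the free nonassociative algebra, without any use of
  antisymmetry. This identity and the next two are the coefficients of l_a^3, l_a^2 l_b and l_a l_b
  l_c when the four-variable syzygy is written for the single bracket sum_a l_a [x, y]_a; the
  coefficients l_i l_j of its Leibniz relation are the \<open>compat_rel i j\<close>.\<close>

lemma syzygy_same: "syzygy a a a p q y z = 0"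
  by (simp add: syzygy_def compat_rel_def jac_def bracket_linear algebra_simps)

lemma syzygy_two: "a \<noteq> b \<Longrightarrow> syzygy b a a p q y z + syzygy a a b p q y z = 0"
  by (simp add: syzygy_def compat_rel_def jac_def bracket_linear algebra_simps)

lemma syzygy_distinct:
  "\<lbrakk>a \<noteq> b; a \<noteq> c; b \<noteq> c\<rbrakk> \<Longrightarrow>
     syzygy a b c p q y z + syzygy b a c p q y z + syzygy c a b p q y z = 0"
  by (simp add: syzygy_def compat_rel_def jac_def bracket_linear algebra_simps)

section \<open>Rewriting rules and their termination\<close>

lemma leaves_nonempty [simp]: "leaves t \<noteq> []"
  by (induction t) auto

lemma valency_Leaf [simp]: "valency (Leaf a) = a"
  by (simp add: valency_def)

lemma valency_Node [simp]: "valency (Node c l r) = min (valency l) (valency r)"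
  by (simp add: valency_def Min_Un)

lemma valency_cong: "mset (leaves u) = mset (leaves t) \<Longrightarrow> valency u = valency t"
  by (metis set_mset_mset valency_def)

text \<open>Over all trees with \<open>m\<close> leaves, the sum over the internal nodes of the number of leaves of the
  right child is largest for right combs, where it is \<open>m (m - 1) / 2\<close>; \<open>defect\<close> is the difference
  to this maximum.\<close>

primrec defect :: "ctree \<Rightarrow> nat" where
  "defect (Leaf a) = 0"
| "defect (Node c l r) = defect l + defect r + length (colors l) * Suc (length (colors r))"

primrec spine_valencies :: "ctree \<Rightarrow> nat multiset" where
  "spine_valencies (Leaf a) = {#}"
| "spine_valencies (Node c l r) = add_mset (valency r) (spine_valencies l)"

primrec spine_colors :: "ctree \<Rightarrow> nat multiset" where
  "spine_colors (Leaf a) = {#}"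
| "spine_colors (Node c l r) = add_mset c (spine_colors l)"

text \<open>The rules exchange the right children of two consecutive nodes on a left spine, so
  termination is that of sorting: this counts the pairs of nodes on a common left spine whose right
  children have valencies increasing from the lower to the upper node. \<open>color_ascents\<close>
  does the same for the colors.\<close>

primrec ascents :: "ctree \<Rightarrow> nat" where
  "ascents (Leaf a) = 0"
| "ascents (Node c l r) =
     ascents l + ascents r + size {#a \<in># spine_valencies l. a < valency r#}"

primrec color_ascents :: "ctree \<Rightarrow> nat" where
  "color_ascents (Leaf a) = 0"
| "color_ascents (Node c l r) =
     color_ascents l + color_ascents r + size {#a \<in># spine_colors l. a < c#}"

text \<open>The equality of the spine multisets makes the order stable under contexts, since an
  outer node sees only these multisets when it counts its ascents. They may change when
  \<open>defect\<close> drops, because \<open>defect\<close> is compared first.\<close>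

definition prec :: "ctree \<Rightarrow> ctree \<Rightarrow> bool" where
  "prec u t \<longleftrightarrow> mset (leaves u) = mset (leaves t) \<and> mset (colors u) = mset (colors t) \<and>
     (defect u < defect t \<or>
      defect u = defect t \<and> spine_valencies u = spine_valencies t \<and>
      spine_colors u = spine_colors t \<and>
      (ascents u < ascents t \<or> ascents u = ascents t \<and> color_ascents u < color_ascents t))"

lemma prec_irrefl [simp]: "\<not> prec t t"
  by (simp add: prec_def)

lemma wf_prec: "wf {(u, t). prec u t}"
  by (rule wf_subset[OF wf_measures[of "[defect, ascents, color_ascents]"]])
     (auto simp: prec_def)

lemma prec_Node_left: "prec u l \<Longrightarrow> prec (Node c u r) (Node c l r)"
  using mset_eq_length[of "colors u" "colors l"] by (auto simp: prec_def)

lemma prec_Node_right: "prec u r \<Longrightarrow> prec (Node c l u) (Node c l r)"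
  using mset_eq_length[of "colors u" "colors r"] valency_cong[of u r]
  by (auto simp: prec_def)

lemma prec_valency: "prec u t \<Longrightarrow> valency u = valency t"
  by (auto simp: prec_def intro: valency_cong)

text \<open>\<open>redex t \<rho>\<close> presents \<rho> as a relation with leading tree
  \<open>t\<close>, so that \<open>t\<close> may be replaced by \<open>elt t - \<rho>\<close>. The
  rule \<open>root\<close> applies where the color condition fails: at a non-Lyndon node whose color
  is at least that of its left child.\<close>

inductive redex :: "ctree \<Rightarrow> (ctree \<Rightarrow>\<^sub>0 'k::field) \<Rightarrow> bool" where
  root: "\<lbrakk>valency x < valency y; valency y < valency z; j \<le> i\<rbrakk> \<Longrightarrow>
    redex (Node i (Node j x y) z) (compat_rel i j (elt x) (elt y) (elt z))"
| left: "redex l \<rho> \<Longrightarrow> redex (Node c l r) (bracket c \<rho> (elt r))"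
| right: "redex r \<rho> \<Longrightarrow> redex (Node c l r) (bracket c (elt l) \<rho>)"

text \<open>\<open>defect\<close> drops by the number of leaves of \<open>z\<close>.\<close>

lemma prec_right_comb:
  "(i', j') \<in> {(i, j), (j, i)} \<Longrightarrow> prec (Node i' x (Node j' y z)) (Node i (Node j x y) z)"
  by (auto simp: prec_def algebra_simps)

text \<open>\<open>defect\<close> is symmetric in \<open>y\<close> and \<open>z\<close>, and exactly
  one ascent, the pair formed by \<open>y\<close> and \<open>z\<close>, disappears. The colors may
  be distributed in either way because \<open>ascents\<close> is compared before
  \<open>color_ascents\<close>.\<close>

lemma prec_swap:
  "\<lbrakk>valency y < valency z; (i', j') \<in> {(i, j), (j, i)}\<rbrakk> \<Longrightarrow>
     prec (Node i' (Node j' x z) y) (Node i (Node j x y) z)"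
  by (auto simp: prec_def algebra_simps)

lemma prec_swap_colors: "j < i \<Longrightarrow> prec (Node j (Node i x y) z) (Node i (Node j x y) z)"
  by (auto simp: prec_def algebra_simps)

lemma compat_rel_leading:
  assumes "valency y < valency z" "j \<le> i"
  shows "Poly_Mapping.lookup (compat_rel i j (elt x) (elt y) (elt z) :: ctree \<Rightarrow>\<^sub>0 'k::field)
      (Node i (Node j x y) z) = 1"
    and "u \<in> Poly_Mapping.keys (compat_rel i j (elt x) (elt y) (elt z) :: ctree \<Rightarrow>\<^sub>0 'k) \<Longrightarrow>
      u = Node i (Node j x y) z \<or> prec u (Node i (Node j x y) z)"
proof -
  let ?t = "Node i (Node j x y) z"
  have p: "prec (Node i x (Node j y z)) ?t" "prec (Node j x (Node i y z)) ?t"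
     "prec (Node i (Node j x z) y) ?t" "prec (Node j (Node i x z) y) ?t"
     "j \<noteq> i \<Longrightarrow> prec (Node j (Node i x y) z) ?t"
    using assms by (auto intro!: prec_right_comb prec_swap prec_swap_colors)
  have ne: "Node i x (Node j y z) \<noteq> ?t" "Node j x (Node i y z) \<noteq> ?t" "Node i (Node j x z) y \<noteq> ?t"
     "Node j (Node i x z) y \<noteq> ?t" "j \<noteq> i \<Longrightarrow> Node j (Node i x y) z \<noteq> ?t"
    using p prec_irrefl by metis+
  show "Poly_Mapping.lookup (compat_rel i j (elt x) (elt y) (elt z) :: ctree \<Rightarrow>\<^sub>0 'k::field) ?t = 1"
    using ne by (auto simp: compat_rel_def jac_def bracket_single lookup_add lookup_minus
      lookup_single when_def simp del: ctree.inject)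
  show "u = ?t \<or> prec u ?t" if 
      "u \<in> Poly_Mapping.keys (compat_rel i j (elt x) (elt y) (elt z) :: ctree \<Rightarrow>\<^sub>0 'k)"
    using that p
    by (auto simp: in_keys_iff compat_rel_def jac_def bracket_single lookup_add lookup_minus
      lookup_single when_def simp del: ctree.inject split: if_splits)
qed

lemma redex_keys:
  assumes "redex t \<rho>"
  shows "Poly_Mapping.lookup \<rho> t = 1 \<and> (\<forall>u\<in>Poly_Mapping.keys \<rho>. u = t \<or> prec u t)"
  using assms
proof induction
  case (root x y z j i)
  then show ?case using compat_rel_leading by blast
next
  case (left l \<rho> c r)
  show ?case
    using left.IH prec_Node_left
    by (force simp: in_keys_iff lookup_bracket lookup_single when_def split: ctree.splits if_splits)
next
  case (right r \<rho> c l)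
  show ?case
    using right.IH prec_Node_right
    by (force simp: in_keys_iff lookup_bracket lookup_single when_def split: ctree.splits if_splits)
qed

text \<open>Confluence is stated relative to this space, as in the diamond lemma: two relations with
  leading tree \<open>t\<close> have to agree up to relations with smaller leading trees. This
  avoids the comparison of common reducts.\<close>

definition below :: "ctree \<Rightarrow> (ctree \<Rightarrow>\<^sub>0 'k::field) set" where
  "below t = pm.span {\<rho>. \<exists>u. prec u t \<and> redex u \<rho>}"

lemma below_redex: "redex u \<rho> \<Longrightarrow> prec u t \<Longrightarrow> \<rho> \<in> below t"
  unfolding below_def by (rule pm.span_base) blast

lemma below_closed:
  "0 \<in> below t"
  "a \<in> below t \<Longrightarrow> b \<in> below t \<Longrightarrow> a + b \<in> below t"
  "a \<in> below t \<Longrightarrow> b \<in> below t \<Longrightarrow> a - b \<in> below t"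
  "a \<in> below t \<Longrightarrow> - a \<in> below t"
  "a \<in> below t \<Longrightarrow> scal c a \<in> below t"
  unfolding below_def by (auto intro: pm.span_add pm.span_diff pm.span_neg pm.span_scale
    pm.span_zero)

lemma below_linear:
  assumes "\<And>x y. f (x + y) = f x + f y" "\<And>c x. f (scal c x) = scal c (f x)"
    and "\<And>u. u \<in> Poly_Mapping.keys p \<Longrightarrow> f (elt u) \<in> below t"
  shows "f p \<in> below t"
proof -
  have "f (\<Sum>u\<in>A. scal (Poly_Mapping.lookup p u) (elt u)) \<in> below t"
    if "finite A" "A \<subseteq> Poly_Mapping.keys p" for A
    using that
  proof (induction A)
    case empty
    have "f 0 = 0" using assms(2)[of 0 0] by simp
    then show ?case by (simp add: below_closed)
  next
    case (insert a A)
    then show ?case using assms by (auto intro!: below_closed)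
  qed
  then show ?thesis by (subst poly_mapping_eq_sum) simp
qed

lemma below_map:
  assumes "\<And>x y. f (x + y) = f x + f y" "\<And>c x. f (scal c x) = scal c (f x)"
    and "\<And>u \<rho>. redex u \<rho> \<Longrightarrow> prec u t \<Longrightarrow> f \<rho> \<in> below s" and "x \<in> below t"
  shows "f x \<in> below s"
  using assms(4) unfolding below_def[of t]
proof (induction rule: pm.span_induct_alt)
  case base
  have "f 0 = 0" using assms(2)[of 0 0] by simp
  then show ?case by (simp add: below_closed)
next
  case (step c x y)
  then show ?case using assms(1-3) by (auto intro!: below_closed)
qed

lemma redex_tail:
  assumes "redex t \<rho>" "u \<in> Poly_Mapping.keys (elt t - \<rho>)"
  shows "prec u t"
  using redex_keys[OF assms(1)] assms(2)
  by (cases "u = t") (auto simp: in_keys_iff lookup_minus lookup_single when_def)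

section \<open>Confluence\<close>

lemma below_left: "x \<in> below l \<Longrightarrow> bracket c x (elt r) \<in> below (Node c l r)"
  by (rule below_map[where f = "\<lambda>x. bracket c x (elt r)"])
     (auto simp: bracket_linear intro: below_redex[OF redex.left] prec_Node_left)

lemma below_right: "x \<in> below r \<Longrightarrow> bracket c (elt l) x \<in> below (Node c l r)"
  by (rule below_map[where f = "\<lambda>x. bracket c (elt l) x"])
     (auto simp: bracket_linear intro: below_redex[OF redex.right] prec_Node_right)

text \<open>The relation is symmetric in the two colors, so its leading tree carries the larger one
  outside.\<close>

lemma redex_compat:
  assumes "valency x < valency y" "valency y < valency z"
  shows "redex (Node (max i j) (Node (min i j) x y) z) (compat_rel i j (elt x) (elt y) (elt z))"
  using redex.root[OF assms, of "min i j" "max i j"]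
  by (cases "i \<le> j") (simp_all add: compat_rel_commute max_def min_def)

lemma below_compat:
  assumes "valency x < valency y" "valency y < valency z"
    and "prec (Node (max i j) (Node (min i j) x y) z) t"
  shows "compat_rel i j (elt x) (elt y) (elt z) \<in> below t"
  using below_redex[OF redex_compat] assms by blast

lemma below_bracket_compat_left:
  assumes "valency x < valency y" "valency y < valency z"
    and "prec (Node k (Node (max i j) (Node (min i j) x y) z) w) t"
  shows "bracket k (compat_rel i j (elt x) (elt y) (elt z)) (elt w) \<in> below t"
  using below_redex[OF redex.left[OF redex_compat]] assms by blast

lemma below_bracket_compat_right:
  assumes "valency x < valency y" "valency y < valency z"
    and "prec (Node k w (Node (max i j) (Node (min i j) x y) z)) t"
  shows "bracket k (elt w) (compat_rel i j (elt x) (elt y) (elt z)) \<in> below t"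
  using below_redex[OF redex.right[OF redex_compat]] assms by blast

lemma bracket_elt: "bracket k (elt x) (elt y) = elt (Node k x y)"
  by (simp add: bracket_single)

text \<open>The two terms taken out are those whose leading trees are built on the left comb with
  \<open>p\<close>, \<open>q\<close>, \<open>y\<close>, \<open>z\<close> in sorted order, the shape
  of the overlap to be resolved.\<close>

definition syzygy_tail where
  "syzygy_tail k i j p q y z = syzygy k i j p q y z
     - compat_rel i j (bracket k p q) y z + bracket k (compat_rel i j p q y) z"

lemma mset_max_min: "{#max i j, min i j#} = {#i, j :: nat#}"
  by (auto simp: max_def min_def)

text \<open>The leading tree of each of the eight remaining terms either has smaller
  \<open>defect\<close> or has the shape of a left comb in which \<open>q\<close>, \<open>y\<close>,
  \<open>z\<close> are out of order, hence fewer ascents. Therefore every distribution of the three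
  colors is allowed.\<close>

lemma syzygy_tail_below:
  assumes v: "valency p < valency q" "valency q < valency y" "valency y < valency z"
    and m: "{#k, i, j#} = {#a, b, c#}"
  shows "(syzygy_tail k i j (elt p) (elt q) (elt y) (elt z) :: ctree \<Rightarrow>\<^sub>0 'k::field)
    \<in> below (Node c (Node b (Node a p q) y) z)"
proof -
  define M N where "M = max i j" and "N = min i j"
  have "{#k, M, N#} = {#a, b, c#}"
    using m by (simp add: M_def N_def flip: mset_max_min[of i j])
  then have perm: "(k, M, N) \<in> {(a, b, c), (a, c, b), (b, a, c), (b, c, a), (c, a, b), (c, b, a)}"
    by (auto simp: add_eq_conv_ex)
  show ?thesis
    unfolding syzygy_tail_def syzygy_def bracket_elt using v
    by (simp add: algebra_simps)
      (intro below_closed below_compat below_bracket_compat_left below_bracket_compat_right;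
       simp flip: M_def N_def; use perm in \<open>auto simp: prec_def algebra_simps\<close>)
qed

text \<open>The terms \<open>H\<close> come from the relation at the root and the terms
  \<open>K\<close> from the one at its left child. A vanishing sum of syzygies expresses
  \<open>H a c b - K c b a\<close> by tails and by terms \<open>H\<close> and \<open>K\<close> with
  other arrangements of the colors; these are smaller because the sorted arrangement has the most
  color ascents. Which sum of syzygies is used depends on which of the colors coincide.\<close>

lemma critical_pair:
  fixes a b c p q y z
  defines "t \<equiv> Node c (Node b (Node a p q) y) z"
  assumes v: "valency p < valency q" "valency q < valency y" "valency y < valency z"
    and le: "a \<le> b" "b \<le> c"
  shows "compat_rel c b (elt (Node a p q)) (elt y) (elt z)
      - bracket c (compat_rel b a (elt p) (elt q) (elt y)) (elt z)
    \<in> (below t :: (ctree \<Rightarrow>\<^sub>0 'k::field) set)"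
proof -
  define H where "H k i j =
    (compat_rel i j (elt (Node k p q)) (elt y) (elt z) :: ctree \<Rightarrow>\<^sub>0 'k)" for k i j
  define K where "K k i j =
    (bracket k (compat_rel i j (elt p) (elt q) (elt y)) (elt z) :: ctree \<Rightarrow>\<^sub>0 'k)" for k i j
  define S where "S k i j =
    (syzygy k i j (elt p) (elt q) (elt y) (elt z) :: ctree \<Rightarrow>\<^sub>0 'k)" for k i j
  define E where "E k i j =
    (syzygy_tail k i j (elt p) (elt q) (elt y) (elt z) :: ctree \<Rightarrow>\<^sub>0 'k)" for k i j
  have S: "S k i j = H k i j - K k i j + E k i j" for k i j
    by (simp add: S_def H_def K_def E_def syzygy_tail_def bracket_elt)
  have E: "E k i j \<in> below t" if "{#k, i, j#} = {#a, b, c#}" for k i j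
    unfolding E_def t_def using syzygy_tail_below[OF v that] .
  have H: "H k i j \<in> below t"
    if "prec (Node (max i j) (Node (min i j) (Node k p q) y) z) t" for k i j
    unfolding H_def using v that by (intro below_compat) auto
  have K: "K k i j \<in> below t"
    if "prec (Node k (Node (max i j) (Node (min i j) p q) y) z) t" for k i j
    unfolding K_def using v that by (intro below_bracket_compat_left) auto
  have *: "x - y \<in> below t" if "x - y = - d" "d \<in> below t" for x y d :: "ctree \<Rightarrow>\<^sub>0 'k"
    using that below_closed(4) by metis
  have "H a c b - K c b a \<in> below t"
  proof -
    consider "a = b" "b = c" | "a = b" "b < c" | "a < b" "b = c" | "a < b" "b < c"
      using le by linarith
    then show ?thesis
    proof cases
      case 1
      have "S a a a = 0" by (simp add: S_def syzygy_same)
      then have "H a a a - K a a a = - E a a a"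
        unfolding S by (simp add: algebra_simps eq_neg_iff_add_eq_0)
      then show ?thesis using 1 E * by auto
    next
      case 2
      have "S c a a + S a a c = 0" using 2 by (simp add: S_def syzygy_two)
      then have "H a a c - K c a a = - (H c a a - K a a c + E c a a + E a a c)"
        unfolding S by (simp add: algebra_simps eq_neg_iff_add_eq_0)
      moreover have "H c a a \<in> below t \<and> K a a c \<in> below t \<and>
        E c a a \<in> below t \<and> E a a c \<in> below t"
        by (intro conjI H K E; use 2 v in \<open>auto simp: t_def prec_def algebra_simps\<close>)
      moreover have "H a c a = H a a c" by (simp add: H_def compat_rel_commute)
      ultimately show ?thesis using 2 by (auto intro: * below_closed)
    next
      case 3
      have "S a b b + S b b a = 0" using 3 by (simp add: S_def syzygy_two)
      then have "H a b b - K b b a = - (H b b a - K a b b + E a b b + E b b a)"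
        unfolding S by (simp add: algebra_simps eq_neg_iff_add_eq_0)
      moreover have "H b b a \<in> below t \<and> K a b b \<in> below t \<and>
        E a b b \<in> below t \<and> E b b a \<in> below t"
        by (intro conjI H K E; use 3 v in \<open>auto simp: t_def prec_def algebra_simps\<close>)
      ultimately show ?thesis using 3 by (auto intro: * below_closed)
    next
      case 4
      have "S a c b + S b c a + S c b a = 0"
        using 4 syzygy_distinct[of a b c "elt p" "elt q" "elt y" "elt z"]
        by (simp add: S_def syzygy_def compat_rel_commute[of b c] compat_rel_commute[of a])
      then have "H a c b - K c b a
          = - (H b c a - K a c b + (H c b a - K b c a) + (E a c b + E b c a + E c b a))"
        unfolding S by (simp add: algebra_simps eq_neg_iff_add_eq_0)
      \<comment> \<open>Read from the inside out, the colors on the spines of the four leading trees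
        are (b, a, c), (b, c, a), (c, a, b) and (a, c, b); each has fewer ascents than (a, b,
        c).\<close>
      moreover have "H b c a \<in> below t \<and> K a c b \<in> below t \<and>
        H c b a \<in> below t \<and> K b c a \<in> below t \<and>
        E a c b \<in> below t \<and> E b c a \<in> below t \<and>
        E c b a \<in> below t"
        by (intro conjI H K E; use 4 v in \<open>auto simp: t_def prec_def algebra_simps\<close>)
      ultimately show ?thesis by (auto intro: * below_closed)
    qed
  qed
  then show ?thesis by (simp add: H_def K_def)
qed

text \<open>Meant for the case that one of \<open>x\<close>, \<open>y\<close>, \<open>z\<close> is
  itself a relation and the other two are trees: every term but the leading one is then the relation
  of a redex inside a smaller tree.\<close>

lemma compat_tail_below:
  assumes "bracket i x (bracket j y z) \<in> below t" "bracket j x (bracket i y z) \<in> below t"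
    and "bracket i (bracket j x z) y \<in> below t" "bracket j (bracket i x z) y \<in> below t"
    and "j \<noteq> i \<Longrightarrow> bracket j (bracket i x y) z \<in> below t"
  shows "compat_rel i j x y z - bracket i (bracket j x y) z \<in> below t"
proof (cases "i = j")
  case True
  have "compat_rel i j x y z - bracket i (bracket j x y) z
    = - (bracket i x (bracket j y z)) - bracket i (bracket j x z) y"
    using True by (simp add: compat_rel_def jac_def)
  then show ?thesis using assms by (auto intro: below_closed)
next
  case False
  have "compat_rel i j x y z - bracket i (bracket j x y) z
    = - (bracket i x (bracket j y z)) - bracket i (bracket j x z) y
      + (bracket j (bracket i x y) z - bracket j x (bracket i y z) - bracket j (bracket i x z) y)"
    using False by (simp add: compat_rel_def jac_def)
  then show ?thesis using assms False by (auto intro: below_closed)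
qed

text \<open>A redex of \<open>x\<close>, \<open>y\<close> or \<open>z\<close> commutes with the redex at the root of \<open>[[x, y], z]\<close>.\<close>

lemma compat_redex_below:
  fixes x y z i j
  defines "t \<equiv> Node i (Node j x y) z"
  assumes v: "valency x < valency y" "valency y < valency z" and le: "j \<le> i"
  shows "redex x \<rho> \<Longrightarrow>
      compat_rel i j (elt x) (elt y) (elt z) - bracket i (bracket j \<rho> (elt y)) (elt z)
        \<in> below t" (is "_ \<Longrightarrow> ?X \<in> _")
    and "redex y \<rho> \<Longrightarrow>
      compat_rel i j (elt x) (elt y) (elt z) - bracket i (bracket j (elt x) \<rho>) (elt z)
        \<in> below t" (is "_ \<Longrightarrow> ?Y \<in> _")
    and "redex z \<rho> \<Longrightarrow>
      compat_rel i j (elt x) (elt y) (elt z) - bracket i (bracket j (elt x) (elt y)) \<rho>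
        \<in> below t" (is "_ \<Longrightarrow> ?Z \<in> _")
proof -
  have p: "prec (Node i x (Node j y z)) t" "prec (Node j x (Node i y z)) t"
     "prec (Node i (Node j x z) y) t" "prec (Node j (Node i x z) y) t"
     "j \<noteq> i \<Longrightarrow> prec (Node j (Node i x y) z) t"
    using v le unfolding t_def by (auto intro!: prec_right_comb prec_swap prec_swap_colors)
  note b = below_redex[OF _ p(1)] below_redex[OF _ p(2)] below_redex[OF _ p(3)]
    below_redex[OF _ p(4)] below_redex[OF _ p(5)]
  have mm: "max i j = i" "min i j = j" using le by auto
  note lin = compat_rel_def jac_def bracket_linear algebra_simps pm.scale_right_distrib
    pm.scale_right_diff_distrib
  note rd = redex.left redex.right
  {
    assume r: "redex x \<rho>"
    \<comment> \<open>The tree \<open>x\<close> is split into \<open>elt x - \<rho>\<close> and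
      \<rho>. The first part consists of trees preceding \<open>x\<close>, so the root relation
      applies at smaller trees; for the second part \<open>compat_tail_below\<close> leaves only the
      leading term.\<close>
    have "compat_rel i j (elt x - \<rho>) (elt y) (elt z) \<in> below t"
    proof (rule below_linear[where f = "\<lambda>x. compat_rel i j x (elt y) (elt z)"])
      fix u assume "u \<in> Poly_Mapping.keys (elt x - \<rho>)"
      then have "prec u x" by (rule redex_tail[OF r])
      then show "compat_rel i j (elt u) (elt y) (elt z) \<in> below t"
        using v unfolding t_def
        by (intro below_compat) (auto simp: mm prec_valency intro: prec_Node_left)
    qed (auto simp: lin)
    moreover have "compat_rel i j \<rho> (elt y) (elt z) - bracket i (bracket j \<rho> (elt y)) (elt z)
      \<in> below t"
      by (rule compat_tail_below; (simp only: bracket_elt)?; (rule b; blast intro: rd r))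
    ultimately have "compat_rel i j (elt x - \<rho>) (elt y) (elt z) +
        (compat_rel i j \<rho> (elt y) (elt z) - bracket i (bracket j \<rho> (elt y)) (elt z)) \<in> below t"
      by (rule below_closed)
    then show "?X \<in> below t" by (simp add: lin split: if_splits)
  }
  {
    assume r: "redex y \<rho>"
    have "compat_rel i j (elt x) (elt y - \<rho>) (elt z) \<in> below t"
    proof (rule below_linear[where f = "\<lambda>y. compat_rel i j (elt x) y (elt z)"])
      fix u assume "u \<in> Poly_Mapping.keys (elt y - \<rho>)"
      then have "prec u y" by (rule redex_tail[OF r])
      then show "compat_rel i j (elt x) (elt u) (elt z) \<in> below t"
        using v unfolding t_def
        by (intro below_compat) (auto simp: mm prec_valency intro: prec_Node_left prec_Node_right)
    qed (auto simp: lin)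
    moreover have "compat_rel i j (elt x) \<rho> (elt z) - bracket i (bracket j (elt x) \<rho>) (elt z)
      \<in> below t"
      by (rule compat_tail_below; (simp only: bracket_elt)?; (rule b; blast intro: rd r))
    ultimately have "compat_rel i j (elt x) (elt y - \<rho>) (elt z) +
        (compat_rel i j (elt x) \<rho> (elt z) - bracket i (bracket j (elt x) \<rho>) (elt z)) \<in> below t"
      by (rule below_closed)
    then show "?Y \<in> below t" by (simp add: lin split: if_splits)
  }
  {
    assume r: "redex z \<rho>"
    have "compat_rel i j (elt x) (elt y) (elt z - \<rho>) \<in> below t"
    proof (rule below_linear[where f = "\<lambda>z. compat_rel i j (elt x) (elt y) z"])
      fix u assume "u \<in> Poly_Mapping.keys (elt z - \<rho>)"
      then have "prec u z" by (rule redex_tail[OF r])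
      then show "compat_rel i j (elt x) (elt y) (elt u) \<in> below t"
        using v unfolding t_def
        by (intro below_compat) (auto simp: mm prec_valency intro: prec_Node_left prec_Node_right)
    qed (auto simp: lin)
    moreover have "compat_rel i j (elt x) (elt y) \<rho> - bracket i (bracket j (elt x) (elt y)) \<rho>
      \<in> below t"
      by (rule compat_tail_below; (simp only: bracket_elt)?; (rule b; blast intro: rd r))
    ultimately have "compat_rel i j (elt x) (elt y) (elt z - \<rho>) +
        (compat_rel i j (elt x) (elt y) \<rho> - bracket i (bracket j (elt x) (elt y)) \<rho>) \<in> below t"
      by (rule below_closed)
    then show "?Z \<in> below t" by (simp add: lin split: if_splits)
  }
qed

text \<open>A second redex in the left child overlaps with the root redex only if it sits at the
  root of that child, which is the critical pair; any other lies inside \<open>x\<close>,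
  \<open>y\<close> or \<open>z\<close>.\<close>

lemma redex_root_nested:
  assumes v: "valency x < valency y" "valency y < valency z" and le: "j \<le> i"
    and "redex (Node i (Node j x y) z) \<sigma>"
  shows "compat_rel i j (elt x) (elt y) (elt z) - \<sigma> \<in> below (Node i (Node j x y) z)"
  using assms(4)
proof (cases rule: redex.cases)
  case root
  then show ?thesis by (simp add: below_closed)
next
  case (left \<sigma>')
  from left(2) show ?thesis
  proof (cases rule: redex.cases)
    case (root p q a)
    then show ?thesis using critical_pair[of p q y z a j i] v le left(1) by simp
  next
    case (left \<rho>)
    then show ?thesis using compat_redex_below(1)[OF v le] \<open>\<sigma> = _\<close> by simp
  next
    case (right \<rho>)
    then show ?thesis using compat_redex_below(2)[OF v le] \<open>\<sigma> = _\<close> by simp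
  qed
next
  case (right \<sigma>')
  then show ?thesis using compat_redex_below(3)[OF v le] by (simp add: bracket_elt)
qed

text \<open>The difference equals \<open>[\<rho>, r - \<sigma>] - [l - \<rho>, \<sigma>]\<close>,
  and the tails \<open>r - \<sigma>\<close> and \<open>l - \<rho>\<close> consist of trees smaller
  than \<open>r\<close> and \<open>l\<close>.\<close>

lemma redex_disjoint:
  assumes l: "redex l \<rho>" and r: "redex r \<sigma>"
  shows "bracket c \<rho> (elt r) - bracket c (elt l) \<sigma> \<in> below (Node c l r)"
proof -
  have "bracket c \<rho> (elt r - \<sigma>) \<in> below (Node c l r)"
    by (rule below_linear[where f = "bracket c \<rho>"])
       (auto simp: bracket_linear intro: below_redex[OF redex.left[OF l]] prec_Node_right
         redex_tail[OF r])
  moreover have "bracket c (elt l - \<rho>) \<sigma> \<in> below (Node c l r)"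
    by (rule below_linear[where f = "\<lambda>x. bracket c x \<sigma>"])
       (auto simp: bracket_linear intro: below_redex[OF redex.right[OF r]] prec_Node_left
         redex_tail[OF l])
  ultimately have "bracket c \<rho> (elt r - \<sigma>) - bracket c (elt l - \<rho>) \<sigma> \<in> below (Node c l r)"
    by (rule below_closed)
  then show ?thesis by (simp add: bracket_linear)
qed

text \<open>Two redexes in the same child are handled by induction, because bracketing with the
  other child maps \<open>below\<close> of the child into \<open>below\<close> of the whole tree.
  The remaining cases are those of a redex at the root and of redexes in different children.\<close>

theorem redex_confluent:
  "redex t \<rho> \<Longrightarrow> redex t \<sigma> \<Longrightarrow> \<rho> - \<sigma> \<in> below t"
proof (induction arbitrary: \<sigma> rule: redex.induct)
  case (root x y z j i)
  then show ?case by (rule redex_root_nested)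
next
  case (left l \<rho> c r)
  have neg: "a - b \<in> below t" if "b - a \<in> below t" for a b :: "ctree \<Rightarrow>\<^sub>0 'a" and t
    using below_closed(4)[OF that] by simp
  from left.prems show ?case
  proof (cases rule: redex.cases)
    case (root x y j)
    have "redex (Node c l r) (bracket c \<rho> (elt r))" by (rule redex.left[OF left.hyps])
    then show ?thesis using redex_root_nested[of x y r j c] root by (auto intro: neg)
  next
    case (left \<sigma>')
    then show ?thesis using below_left[OF left.IH[of \<sigma>']] by (simp add: bracket_linear)
  next
    case (right \<sigma>')
    then show ?thesis using redex_disjoint left.hyps by blast
  qed
next
  case (right r \<rho> c l)
  have neg: "a - b \<in> below t" if "b - a \<in> below t" for a b :: "ctree \<Rightarrow>\<^sub>0 'a" and t
    using below_closed(4)[OF that] by simp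
  from right.prems show ?case
  proof (cases rule: redex.cases)
    case (root x y j)
    have "redex (Node c l r) (bracket c (elt l) \<rho>)" by (rule redex.right[OF right.hyps])
    then show ?thesis using redex_root_nested[of x y r j c] root by (auto intro: neg)
  next
    case (left \<sigma>')
    then show ?thesis using neg[OF redex_disjoint[OF left(2) right.hyps]] by simp
  next
    case (right \<sigma>')
    then show ?thesis using below_right[OF right.IH[of \<sigma>']] by (simp add: bracket_linear)
  qed
qed

section \<open>Linear extension of maps on trees, and the space of all relations\<close>

definition extend :: "(ctree \<Rightarrow> (ctree \<Rightarrow>\<^sub>0 'k)) \<Rightarrow> (ctree \<Rightarrow>\<^sub>0 'k) \<Rightarrow> (ctree \<Rightarrow>\<^sub>0 'k::field)" where
  "extend f p = (\<Sum>t\<in>Poly_Mapping.keys p. scal (Poly_Mapping.lookup p t) (f t))"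

text \<open>As a congruence rule it tells the function package that a recursive call through
  \<open>extend\<close> reaches only the trees that occur in the argument; the termination of
  \<open>normal_form\<close> rests on this.\<close>

lemma extend_cong [fundef_cong]:
  "p = q \<Longrightarrow> (\<And>t. t \<in> Poly_Mapping.keys q \<Longrightarrow> f t = g t) \<Longrightarrow> extend f p = extend g q"
  by (simp add: extend_def)

lemma extend_superset:
  "finite A \<Longrightarrow> Poly_Mapping.keys p \<subseteq> A \<Longrightarrow>
    extend f p = (\<Sum>t\<in>A. scal (Poly_Mapping.lookup p t) (f t))"
  unfolding extend_def by (rule sum.mono_neutral_left) (auto simp: in_keys_iff)

lemma extend_add: "extend f (p + q) = extend f p + extend f q"
proof -
  let ?A = "Poly_Mapping.keys p \<union> Poly_Mapping.keys q"
  have "Poly_Mapping.keys (p + q) \<subseteq> ?A" by (rule Poly_Mapping.keys_add)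
  then show ?thesis
    by (simp add: extend_superset[of ?A] lookup_add pm.scale_left_distrib sum.distrib)
qed

lemma extend_scal: "extend f (scal c p) = scal c (extend f p)"
  using keys_scal[of c p]
  by (simp add: extend_superset[of "Poly_Mapping.keys p"] pm.scale_sum_right)

lemma extend_zero [simp]: "extend f 0 = 0"
  by (simp add: extend_def)

lemma extend_uminus: "extend f (- p) = - extend f p"
  using extend_scal[of f "- 1" p] by simp

lemma extend_diff: "extend f (p - q) = extend f p - extend f q"
  using extend_add[of f p "- q"] by (simp add: extend_uminus)

lemma extend_elt [simp]: "extend f (elt t) = f t"
  by (simp add: extend_def)

lemmas extend_linear = extend_add extend_diff extend_scal extend_uminus

lemma extend_of_linear:
  assumes "\<And>p q. f (p + q) = f p + f q" "\<And>c p. f (scal c p) = scal c (f p)"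
  shows "extend (\<lambda>t. f (elt t)) p = f p"
  by (induction p rule: poly_mapping_linear_induct) (simp_all add: extend_linear assms)

lemma poly_mapping_linear_eqI:
  assumes "\<And>p q. f (p + q) = f p + f q" "\<And>c p. f (scal c p) = scal c (f p)"
    and "\<And>p q. g (p + q) = g p + g q" "\<And>c p. g (scal c p) = scal c (g p)"
    and "\<And>t. f (elt t) = g (elt t)"
  shows "f p = g p"
  by (induction p rule: poly_mapping_linear_induct) (simp_all add: assms)

definition relations :: "(ctree \<Rightarrow>\<^sub>0 'k::field) set" where
  "relations = pm.span {\<rho>. \<exists>t. redex t \<rho>}"

lemma relations_closed:
  "0 \<in> relations"
  "a \<in> relations \<Longrightarrow> b \<in> relations \<Longrightarrow> a + b \<in> relations"
  "a \<in> relations \<Longrightarrow> - a \<in> relations"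
  "a \<in> relations \<Longrightarrow> scal c a \<in> relations"
  unfolding relations_def by (auto intro: pm.span_add pm.span_neg pm.span_scale pm.span_zero)

lemma redex_relations: "redex t \<rho> \<Longrightarrow> \<rho> \<in> relations"
  unfolding relations_def by (rule pm.span_base) blast

lemma extend_relations:
  assumes "\<And>t \<rho>. redex t \<rho> \<Longrightarrow> extend f \<rho> \<in> relations" and "x \<in> relations"
  shows "extend f x \<in> relations"
  using assms(2) unfolding relations_def
proof (induction rule: pm.span_induct_alt)
  case base
  then show ?case by (simp add: pm.span_zero)
next
  case (step c x y)
  then show ?case using assms(1) unfolding relations_def
    by (auto simp: extend_linear intro!: pm.span_add pm.span_scale)
qed

section \<open>Normal forms\<close>

text \<open>An arbitrary redex is chosen at each stage. That the choice does not matter is shown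
  afterwards from confluence.\<close>

function normal_form :: "ctree \<Rightarrow> (ctree \<Rightarrow>\<^sub>0 'k::field)" where
  "normal_form t = (if \<exists>\<rho> :: ctree \<Rightarrow>\<^sub>0 'k. redex t \<rho>
     then extend normal_form (elt t - (SOME \<rho>. redex t \<rho>)) else elt t)"
  by auto
termination
proof (relation "{(u, t). prec u t}")
  fix t u
  assume ex: "\<exists>\<rho> :: ctree \<Rightarrow>\<^sub>0 'k::field. redex t \<rho>"
    and u: "u \<in> Poly_Mapping.keys (elt t - (SOME \<rho> :: ctree \<Rightarrow>\<^sub>0 'k. redex t \<rho>))"
  show "(u, t) \<in> {(u, t). prec u t}"
    using redex_tail[OF someI_ex[OF ex] u] by simp
qed (rule wf_prec)

declare normal_form.simps [simp del]

text \<open>For the chosen relation \<sigma> the recursion gives the normal form of \<open>t\<close>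
  as that of \<open>elt t - \<sigma>\<close>, so \<sigma> is sent to 0. Any other relation \<rho>
  with leading tree \<open>t\<close> differs from \<sigma> by an element of \<open>below t\<close>,
  which is sent to 0 by induction.\<close>

lemma normal_form_redex: "redex t \<rho> \<Longrightarrow> extend normal_form \<rho> = 0"
proof (induction t arbitrary: \<rho> rule: wf_induct_rule[OF wf_prec])
  case (1 t)
  have below: "extend normal_form x = 0" if "x \<in> below t" for x :: "ctree \<Rightarrow>\<^sub>0 'a"
    using that unfolding below_def
  proof (induction rule: pm.span_induct_alt)
    case (step c x y)
    then show ?case using 1(1) by (auto simp: extend_linear)
  qed simp
  define \<sigma> where "\<sigma> = (SOME \<sigma> :: ctree \<Rightarrow>\<^sub>0 'a. redex t \<sigma>)"
  have \<sigma>: "redex t \<sigma>" unfolding \<sigma>_def using 1(2) by (rule someI)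
  have "normal_form t = extend normal_form (elt t - \<sigma>)"
    using 1(2) by (subst normal_form.simps) (auto simp: \<sigma>_def)
  then have "extend normal_form \<sigma> = 0" by (simp add: extend_linear)
  moreover have "extend normal_form (\<rho> - \<sigma>) = 0"
    using redex_confluent[OF 1(2) \<sigma>] by (rule below)
  ultimately show ?case by (simp add: extend_linear)
qed

text \<open>The normal form map vanishes on relations and fixes irreducible trees.\<close>

lemma relations_irreducible:
  assumes "x \<in> relations" and "\<And>t \<rho>. t \<in> Poly_Mapping.keys x \<Longrightarrow> \<not> redex t (\<rho> :: ctree \<Rightarrow>\<^sub>0 'k::field)"
  shows "x = (0 :: ctree \<Rightarrow>\<^sub>0 'k)"
proof -
  have "extend normal_form x = 0"
    using assms(1) unfolding relations_def
  proof (induction rule: pm.span_induct_alt)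
    case (step c x y)
    then show ?case using normal_form_redex by (auto simp: extend_linear)
  qed simp
  moreover have "extend normal_form x = extend elt x"
    using assms(2) by (intro extend_cong refl) (auto simp: normal_form.simps)
  moreover have "extend elt x = x"
    using extend_of_linear[of "\<lambda>x. x"] by simp
  ultimately show ?thesis by simp
qed

section \<open>Normalization\<close>

primrec straighten :: "ctree \<Rightarrow> ctree" where
  "straighten (Leaf a) = Leaf a"
| "straighten (Node c l r) = (if valency l < valency r then Node c (straighten l) (straighten r)
     else Node c (straighten r) (straighten l))"

primrec straighten_sign :: "ctree \<Rightarrow> 'k::field" where
  "straighten_sign (Leaf a) = 1"
| "straighten_sign (Node c l r) =
     (if valency l < valency r then 1 else - 1) * straighten_sign l * straighten_sign r"

text \<open>Distinct labels exclude ties between the valencies of two siblings, so the sign is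
  alternating. Sending all other trees to 0 respects the defining relations, since all words in such
  a relation between trees have the same labels.\<close>

definition signed :: "ctree \<Rightarrow> (ctree \<Rightarrow>\<^sub>0 'k::field)" where
  "signed t = (if distinct (leaves t) then scal (straighten_sign t) (elt (straighten t)) else 0)"

lemma mset_leaves_straighten [simp]: "mset (leaves (straighten t)) = mset (leaves t)"
  by (induction t) auto

lemma mset_colors_straighten [simp]: "mset (colors (straighten t)) = mset (colors t)"
  by (induction t) auto

lemma valency_straighten [simp]: "valency (straighten t) = valency t"
  by (rule valency_cong) simp

lemma set_leaves_straighten [simp]: "set (leaves (straighten t)) = set (leaves t)"
  by (metis mset_leaves_straighten set_mset_mset)

lemma distinct_leaves_straighten [simp]: "distinct (leaves (straighten t)) = distinct (leaves t)"
  by (metis mset_leaves_straighten mset_eq_imp_distinct_iff)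

lemma valency_neq:
  assumes "set (leaves s) \<inter> set (leaves t) = {}"
  shows "valency s \<noteq> valency t"
proof -
  have "valency u \<in> set (leaves u)" for u by (simp add: valency_def)
  then show ?thesis using assms by (metis disjoint_iff)
qed

lemma signed_Node_swap: "signed (Node j s t) = - signed (Node j t s)"
  using valency_neq[of s t] by (auto simp: signed_def mult.commute)

lemma signed_antisymmetric: "extend signed (bracket j x y) = - extend signed (bracket j y x)"
proof (induction x rule: poly_mapping_linear_induct)
  case (single s)
  show ?case
  proof (induction y rule: poly_mapping_linear_induct)
    case (single t)
    show ?case by (simp add: bracket_elt signed_Node_swap[of j s t])
  qed (simp_all add: bracket_linear extend_linear)
qed (simp_all add: bracket_linear extend_linear)

text \<open>The map induced by \<open>x \<mapsto> [t, x]\<^sub>j\<close> on straightened trees.\<close>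

definition left_mult :: "nat \<Rightarrow> ctree \<Rightarrow> ctree \<Rightarrow> (ctree \<Rightarrow>\<^sub>0 'k::field)" where
  "left_mult j t u = (if distinct (leaves t @ leaves u) then
      scal (straighten_sign t) (if valency t < valency u then elt (Node j (straighten t) u)
         else - elt (Node j u (straighten t))) else 0)"

lemma signed_bracket: "extend signed (bracket j (elt t) p)
  = extend (left_mult j t) (extend signed p)"
proof (rule poly_mapping_linear_eqI[where p = p])
  fix u
  show "extend signed (bracket j (elt t) (elt u)) = extend (left_mult j t) (extend signed (elt u))"
    by (auto simp: bracket_elt signed_def left_mult_def extend_linear mult.commute)
qed (simp_all add: bracket_linear extend_linear)

text \<open>All trees in \<rho> have the labels and the valency of \<open>u\<close>, so
  \<open>left_mult\<close> takes the same branch on each of them. The image is 0 or a multiple of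
  the bracket of \<rho> with a tree, which is again a relation by \<open>redex.left\<close> or
  \<open>redex.right\<close>.\<close>

lemma left_mult_redex:
  assumes r: "redex u \<rho>"
  shows "extend (left_mult j t) \<rho> \<in> relations"
proof -
  have same: "mset (leaves w) = mset (leaves u)" if "w \<in> Poly_Mapping.keys \<rho>" for w
    using redex_keys[OF r] that by (auto simp: prec_def)
  have same': "set (leaves w) = set (leaves u)" "valency w = valency u"
    "distinct (leaves w) = distinct (leaves u)"
    if "w \<in> Poly_Mapping.keys \<rho>" for w
    using same[OF that] valency_cong mset_eq_imp_distinct_iff by (metis set_mset_mset)+
  consider "\<not> distinct (leaves t @ leaves u)"
    | "distinct (leaves t @ leaves u)" "valency t < valency u"
    | "distinct (leaves t @ leaves u)" "\<not> valency t < valency u" by blast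
  then show ?thesis
  proof cases
    case 1
    then have "extend (left_mult j t) \<rho> = extend (\<lambda>_. 0) \<rho>"
      by (intro extend_cong) (auto simp: left_mult_def same')
    then show ?thesis by (simp add: extend_def relations_closed)
  next
    case 2
    then have "extend (left_mult j t) \<rho>
        = extend (\<lambda>w. scal (straighten_sign t) (bracket j (elt (straighten t)) (elt w))) \<rho>"
      by (intro extend_cong) (auto simp: left_mult_def same' bracket_elt)
    also have "\<dots> = scal (straighten_sign t) (bracket j (elt (straighten t)) \<rho>)"
      by (rule extend_of_linear[where f = "\<lambda>x. scal _ (bracket j _ x)"])
         (simp_all add: bracket_linear pm.scale_right_distrib mult.commute)
    also have "\<dots> \<in> relations"
      by (intro relations_closed redex_relations[OF redex.right[OF r]])
    finally show ?thesis .
  next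
    case 3
    then have "extend (left_mult j t) \<rho>
        = extend (\<lambda>w. scal (- straighten_sign t) (bracket j (elt w) (elt (straighten t)))) \<rho>"
      by (intro extend_cong) (auto simp: left_mult_def same' bracket_elt)
    also have "\<dots> = scal (- straighten_sign t) (bracket j \<rho> (elt (straighten t)))"
      by (rule extend_of_linear[where f = "\<lambda>x. scal _ (bracket j x _)"])
         (simp_all add: bracket_linear pm.scale_right_distrib mult.commute)
    also have "\<dots> \<in> relations"
      by (intro relations_closed redex_relations[OF redex.left[OF r]])
    finally show ?thesis .
  qed
qed

lemma signed_bracket_relations:
  assumes "extend signed p \<in> relations"
  shows "extend signed (bracket j x p) \<in> relations"
proof (induction x rule: poly_mapping_linear_induct)
  case (single t)
  show ?case
    unfolding signed_bracket using left_mult_redex assms by (rule extend_relations)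
qed (simp_all add: bracket_linear extend_linear relations_closed)

section \<open>Images of the Jacobi sums under signed straightening\<close>

definition cyclic where
  "cyclic i j x y z =
     bracket i x (bracket j y z) + bracket i z (bracket j x y) + bracket i y (bracket j z x)"

lemma signed_cyclic_rotate: "extend signed (cyclic i j x y z) = extend signed (cyclic i j y z x)"
  by (simp add: cyclic_def extend_linear)

text \<open>Reversing the cyclic order reverses each inner bracket, and
  \<open>signed_bracket\<close> allows antisymmetry to be applied inside the outer bracket.\<close>

lemma signed_cyclic_swap: "extend signed (cyclic i j x z y) = - extend signed (cyclic i j x y z)"
proof -
  have *: "extend signed (bracket i u (bracket j v w)) =
    - extend signed (bracket i u (bracket j w v))" for u v w
  proof (induction u rule: poly_mapping_linear_induct)
    case (single t)
    show ?case by (simp add: signed_bracket signed_antisymmetric[of j v w] extend_linear)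
  qed (simp_all add: bracket_linear extend_linear)
  show ?thesis
    by (simp add: cyclic_def extend_linear *[of x z y] *[of y x z] *[of z y x])
qed

text \<open>For increasing valencies \<open>[x, [y, z]]\<close> is already in order,
  \<open>[z, [x, y]]\<close> needs one exchange and \<open>[y, [z, x]]\<close> needs two; the
  resulting signs are those of minus \<open>jac\<close>.\<close>

lemma signed_cyclic_sorted:
  assumes "valency x < valency y" "valency y < valency z"
    "distinct (leaves x @ leaves y @ leaves z)"
  shows "extend signed (cyclic i j (elt x) (elt y) (elt z)) =
    scal (- (straighten_sign x * straighten_sign y * straighten_sign z))
      (jac i j (elt (straighten x)) (elt (straighten y)) (elt (straighten z)))"
  using assms
  by (auto simp: cyclic_def extend_linear bracket_elt signed_def jac_def pm.scale_right_diff_distrib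
     pm.scale_right_distrib mult_ac)

definition compat_cyclic where
  "compat_cyclic i j x y z =
     (if i = j then cyclic i i x y z else cyclic i j x y z + cyclic j i x y z)"

text \<open>The image is invariant under rotation and changes sign under a transposition, so the six
  possible orders of the valencies reduce to the increasing one, where it is a multiple of a redex
  relation.\<close>

lemma signed_compat_cyclic_elt:
  "extend signed (compat_cyclic i j (elt x) (elt y) (elt z))
    \<in> (relations :: (ctree \<Rightarrow>\<^sub>0 'k::field) set)"
proof (cases "distinct (leaves x @ leaves y @ leaves z)")
  case False
  \<comment> \<open>These are the leaf lists of the three words in the cyclic sum, so
    \<open>signed\<close> sends each of them to 0.\<close>
  then have "\<not> distinct (leaves x @ leaves y @ leaves z)"
    "\<not> distinct (leaves z @ leaves x @ leaves y)"
    "\<not> distinct (leaves y @ leaves z @ leaves x)" by auto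
  then have "extend signed (cyclic i j (elt x) (elt y) (elt z)) = (0 :: ctree \<Rightarrow>\<^sub>0 'k)" for i j
    by (simp only: cyclic_def extend_linear bracket_elt extend_elt signed_def leaves.simps
      if_False add_0_left)
  then show ?thesis by (simp add: compat_cyclic_def extend_linear relations_closed)
next
  case True
  let ?P = "\<lambda>x y z. extend signed (compat_cyclic i j (elt x) (elt y) (elt z))
    \<in> (relations :: (ctree \<Rightarrow>\<^sub>0 'k) set)"
  have rot: "?P x y z \<longleftrightarrow> ?P y z x" for x y z
    by (simp add: compat_cyclic_def extend_linear signed_cyclic_rotate[of _ _ "elt x" "elt y"
      "elt z"])
  have swap: "?P x y z \<Longrightarrow> ?P x z y" for x y z
  proof -
    assume "?P x y z"
    moreover have "extend signed (compat_cyclic i j (elt x) (elt z) (elt y))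
        = - (extend signed (compat_cyclic i j (elt x) (elt y) (elt z)) :: ctree \<Rightarrow>\<^sub>0 'k)"
      by (simp add: compat_cyclic_def extend_linear signed_cyclic_swap[of _ _ "elt x" "elt z"
        "elt y"])
    ultimately show "?P x z y" by (simp add: relations_closed)
  qed
  have sorted: "?P x y z" if "valency x < valency y" "valency y < valency z"
      "distinct (leaves x @ leaves y @ leaves z)" for x y z
  proof -
    have "compat_rel i j (elt (straighten x)) (elt (straighten y)) (elt (straighten z))
      \<in> (relations :: (ctree \<Rightarrow>\<^sub>0 'k) set)"
      using that by (intro redex_relations[OF redex_compat]) auto
    from relations_closed(4)[OF this, of
      "- (straighten_sign x * straighten_sign y * straighten_sign z)"]
    show ?thesis
      using that by (simp add: compat_cyclic_def compat_rel_def extend_linear signed_cyclic_sorted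
         pm.scale_right_distrib split: if_splits)
  qed
  have "valency x \<noteq> valency y" "valency y \<noteq> valency z" "valency x \<noteq> valency z"
    using True by (auto intro!: valency_neq)
  then consider "valency x < valency y" "valency y < valency z"
    | "valency x < valency z" "valency z < valency y"
    | "valency y < valency x" "valency x < valency z"
    | "valency y < valency z" "valency z < valency x"
    | "valency z < valency x" "valency x < valency y"
    | "valency z < valency y" "valency y < valency x"
    by linarith
  then show ?thesis
  proof cases
    case 1 then show ?thesis using True by (intro sorted) auto
  next
    case 2 then show ?thesis using True by (intro swap[of x z y] sorted) auto
  next
    case 3
    then have "?P y x z" using True by (intro sorted) auto
    then show ?thesis using swap[of y x z] rot[of x y z] by blast
  next
    case 4
    then have "?P y z x" using True by (intro sorted) auto
    then show ?thesis using rot[of x y z] by blast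
  next
    case 5
    then have "?P z x y" using True by (intro sorted) auto
    then show ?thesis using rot[of z x y] by blast
  next
    case 6
    then have "?P z y x" using True by (intro sorted) auto
    then show ?thesis using swap[of z y x] rot[of z x y] by blast
  qed
qed

lemma compat_cyclic_add:
  "compat_cyclic i j (p + q) y z = compat_cyclic i j p y z + compat_cyclic i j q y z"
  "compat_cyclic i j x (p + q) z = compat_cyclic i j x p z + compat_cyclic i j x q z"
  "compat_cyclic i j x y (p + q) = compat_cyclic i j x y p + compat_cyclic i j x y q"
  by (simp_all add: compat_cyclic_def cyclic_def bracket_linear add_ac)

lemma compat_cyclic_scal:
  "compat_cyclic i j (scal c p) y z = scal c (compat_cyclic i j p y z)"
  "compat_cyclic i j x (scal c p) z = scal c (compat_cyclic i j x p z)"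
  "compat_cyclic i j x y (scal c p) = scal c (compat_cyclic i j x y p)"
  by (simp_all add: compat_cyclic_def cyclic_def bracket_linear pm.scale_right_distrib)

lemma signed_compat_cyclic: "extend signed (compat_cyclic i j x y z) \<in> relations"
proof (induction x rule: poly_mapping_linear_induct)
  case (single s)
  show ?case
  proof (induction y rule: poly_mapping_linear_induct)
    case (single t)
    show ?case
    proof (induction z rule: poly_mapping_linear_induct)
      case (single u)
      show ?case by (rule signed_compat_cyclic_elt)
    qed (simp_all add: compat_cyclic_add compat_cyclic_scal extend_linear relations_closed)
  qed (simp_all add: compat_cyclic_add compat_cyclic_scal extend_linear relations_closed)
qed (simp_all add: compat_cyclic_add compat_cyclic_scal extend_linear relations_closed)

lemma signed_lie_ideal: "p \<in> lie_ideal n \<Longrightarrow> extend signed p \<in> relations"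
proof (induction rule: lie_ideal.induct)
  case (antisymmetry j x y)
  show ?case by (simp add: extend_linear signed_antisymmetric[of j x y] relations_closed)
next
  case (jacobi j x y z)
  show ?case using signed_compat_cyclic[of j j x y z] by (simp add: compat_cyclic_def cyclic_def)
next
  case (mixed_jacobi i j x y z)
  then show ?case using signed_compat_cyclic[of i j x y z]
    by (simp add: compat_cyclic_def cyclic_def add.assoc)
next
  case (bracket_right j x p)
  then show ?case
    using relations_closed(3)[OF signed_bracket_relations[of p j x]]
    by (simp add: signed_antisymmetric[of j p x])
qed (simp_all add: extend_linear relations_closed signed_bracket_relations)

section \<open>Colored Lyndon trees as normal forms\<close>

lemma lie_ideal_uminus: "p \<in> lie_ideal n \<Longrightarrow> - p \<in> lie_ideal n"
  using lie_ideal.scal[of p n "- 1"] by simp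

lemma lie_ideal_diff: "p \<in> lie_ideal n \<Longrightarrow> q \<in> lie_ideal n \<Longrightarrow> p - q \<in> lie_ideal n"
  using lie_ideal.add[of p n "- q"] lie_ideal_uminus[of q n] by simp

lemma words_Leaf [simp]: "Leaf a \<in> words n \<longleftrightarrow> a \<in> {1..n}"
  by (simp add: words_def)

lemma words_Node [simp]: "Node c l r \<in> words n \<longleftrightarrow> 1 \<le> c \<and> l \<in> words n \<and> r \<in> words n"
  by (auto simp: words_def)

lemma words_cong:
  "mset (leaves u) = mset (leaves t) \<Longrightarrow> mset (colors u) = mset (colors t) \<Longrightarrow>
    u \<in> words n \<longleftrightarrow> t \<in> words n"
  using mset_eq_setD[of "leaves u" "leaves t"] mset_eq_setD[of "colors u" "colors t"]
  by (simp add: words_def)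

lemma elt_carrier: "t \<in> words n \<Longrightarrow> elt t \<in> carrier (magma_algebra n)"
  by simp

text \<open>Up to antisymmetry \<open>jac\<close> is minus the cyclic sum. Hence
  \<open>compat_rel\<close> is minus \<open>compat_cyclic\<close> modulo the ideal, and
  \<open>compat_cyclic\<close> is one of its generators.\<close>

lemma lie_ideal_compat_rel:
  assumes "1 \<le> i" "1 \<le> j" and x: "x \<in> carrier (magma_algebra n)"
    and y: "y \<in> carrier (magma_algebra n)" and z: "z \<in> carrier (magma_algebra n)"
  shows "compat_rel i j x y z \<in> lie_ideal n"
proof -
  have sum: "jac i j x y z + cyclic i j x y z \<in> lie_ideal n" if "1 \<le> i" "1 \<le> j" for i j
  proof -
    have "jac i j x y z + cyclic i j x y z =
      (bracket i (bracket j x y) z + bracket i z (bracket j x y))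
      + bracket i y (bracket j z x + bracket j x z)
      - (bracket i y (bracket j x z) + bracket i (bracket j x z) y)"
      by (simp add: jac_def cyclic_def bracket_linear)
    also have "\<dots> \<in> lie_ideal n"
      using that x y z
      by (intro lie_ideal_diff lie_ideal.add lie_ideal.bracket_left lie_ideal.antisymmetry
        bracket_closed)
    finally show ?thesis .
  qed
  have cyc: "compat_cyclic i j x y z \<in> lie_ideal n"
  proof (cases "i = j")
    case True
    then show ?thesis
      using lie_ideal.jacobi[OF assms(1) x y z] by (simp add: compat_cyclic_def cyclic_def)
  next
    case False
    then show ?thesis
      using lie_ideal.mixed_jacobi[OF assms(1,2) False x y z]
      by (simp add: compat_cyclic_def cyclic_def add.assoc)
  qed
  have "compat_rel i j x y z + compat_cyclic i j x y z \<in> lie_ideal n"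
    using sum[OF assms(1,2)] lie_ideal.add[OF sum[OF assms(1,2)] sum[OF assms(2,1)]]
    by (cases "i = j") (simp_all add: compat_rel_def compat_cyclic_def add_ac)
  from lie_ideal_diff[OF this cyc] show ?thesis by simp
qed

lemma redex_lie_ideal: "redex t \<rho> \<Longrightarrow> t \<in> words n \<Longrightarrow> \<rho> \<in> lie_ideal n"
proof (induction rule: redex.induct)
  case (root x y z j i)
  then show ?case by (intro lie_ideal_compat_rel elt_carrier) simp_all
next
  case (left l \<rho> c r)
  then show ?case by (intro lie_ideal.bracket_right elt_carrier) simp_all
next
  case (right r \<rho> c l)
  then show ?case by (intro lie_ideal.bracket_left elt_carrier) simp_all
qed

lemma straighten_words [simp]: "straighten t \<in> words n \<longleftrightarrow> t \<in> words n"
  by (rule words_cong) simp_all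

lemma straighten_lie_ideal:
  "t \<in> words n \<Longrightarrow> elt t - scal (straighten_sign t) (elt (straighten t)) \<in> lie_ideal n"
proof (induction t)
  case (Leaf a)
  show ?case by (simp add: lie_ideal.zero)
next
  case (Node c l r)
  define L R where "L = scal (straighten_sign l) (elt (straighten l) :: ctree \<Rightarrow>\<^sub>0 'a)"
    and "R = scal (straighten_sign r) (elt (straighten r) :: ctree \<Rightarrow>\<^sub>0 'a)"
  have c: "1 \<le> c" "l \<in> words n" "r \<in> words n" using Node.prems by auto
  have LR: "L \<in> carrier (magma_algebra n)" "R \<in> carrier (magma_algebra n)"
    unfolding L_def R_def using c by (intro magma_algebra_scal_closed elt_carrier; simp)+
  have "bracket c (elt l - L) (elt r) + bracket c L (elt r - R) \<in> lie_ideal n"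
    using lie_ideal.add[OF lie_ideal.bracket_right[OF c(1) elt_carrier[OF c(3)] Node.IH(1)[OF c(2)]]
        lie_ideal.bracket_left[OF c(1) LR(1) Node.IH(2)[OF c(3)]]]
    unfolding L_def R_def .
  \<comment> \<open>Both children are replaced one after the other:
    \<open>[l - L, r] + [L, r - R]\<close> telescopes to \<open>[l, r] - [L, R]\<close>.\<close>
  then have 1: "elt (Node c l r) - bracket c L R \<in> lie_ideal n"
    by (simp add: bracket_linear bracket_elt)
  show ?case
  proof (cases "valency l < valency r")
    case True
    then show ?thesis using 1 by (simp add: L_def R_def bracket_linear bracket_elt mult_ac)
  next
    case False
    have "elt (Node c l r) - bracket c L R + (bracket c L R + bracket c R L) \<in> lie_ideal n"
      using 1 LR c by (intro lie_ideal.add lie_ideal.antisymmetry)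
    then have "elt (Node c l r) + bracket c R L \<in> lie_ideal n" by simp
    then show ?thesis using False by (simp add: L_def R_def bracket_linear bracket_elt mult_ac)
  qed
qed

section \<open>Colored Lyndon trees as the irreducible normalized trees\<close>

lemma normalized_Leaf [simp]: "normalized (Leaf a)"
  by (simp add: normalized_def)

lemma normalized_Node [simp]:
  "normalized (Node c l r) \<longleftrightarrow> valency l \<le> valency r \<and> normalized l \<and> normalized r"
  unfolding normalized_def by (auto simp: min_def)

lemma colored_lyndon_Leaf [simp]: "colored_lyndon (Leaf a)"
  by (simp add: colored_lyndon_def)

lemma colored_lyndon_Node:
  "colored_lyndon (Node c l r) \<longleftrightarrow> valency l \<le> valency r \<and> colored_lyndon l \<and> colored_lyndon r \<and>
    (\<forall>c' l' r'. l = Node c' l' r' \<longrightarrow> valency r' \<le> valency r \<longrightarrow> c < c')"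
  unfolding colored_lyndon_def by (auto simp: not_less)

lemma colored_lyndon_normalized: "colored_lyndon t \<Longrightarrow> normalized t"
  by (simp add: colored_lyndon_def)

lemma normalized_straighten: "normalized (straighten t)"
  by (induction t) auto

lemma straighten_normalized:
  "normalized t \<Longrightarrow> distinct (leaves t) \<Longrightarrow>
    straighten t = t \<and> straighten_sign t = (1 :: 'k::field)"
proof (induction t)
  case (Node c l r)
  then have "valency l < valency r" using valency_neq[of l r] by (auto simp: le_neq_implies_less)
  then show ?case using Node by auto
qed simp

lemma colored_lyndon_irreducible: "redex t \<rho> \<Longrightarrow> \<not> colored_lyndon t"
  by (induction rule: redex.induct) (auto simp: colored_lyndon_Node)

text \<open>A lowest failure of the color condition is a root redex: distinct labels turn the weak
  inequalities of a normalized non-Lyndon node into the strict ones that \<open>root\<close>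
  demands.\<close>

lemma exists_redex:
  "normalized t \<Longrightarrow> distinct (leaves t) \<Longrightarrow> \<not> colored_lyndon t \<Longrightarrow>
    \<exists>\<rho> :: ctree \<Rightarrow>\<^sub>0 'k::field. redex t \<rho>"
proof (induction t)
  case (Node c l r)
  show ?case
  proof (cases "colored_lyndon l \<and> colored_lyndon r")
    case True
    with Node.prems obtain c' l' r' where l: "l = Node c' l' r'" "valency r' \<le> valency r" "c' \<le> c"
      by (auto simp: colored_lyndon_Node not_less)
    have "valency l' \<noteq> valency r'" "valency r' \<noteq> valency r"
      using Node.prems l by (auto intro!: valency_neq)
    then have "valency l' < valency r'" "valency r' < valency r"
      using Node.prems l by auto
    then show ?thesis using redex.root[of l' r' r c' c] l by blast
  next
    case False
    then show ?thesis using Node redex.left redex.right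
      by (metis distinct_append leaves.simps(2) normalized_Node)
  qed
qed simp

section \<open>Colored Lyndon trees span modulo the ideal\<close>

lemma redex_normalized:
  "redex t \<rho> \<Longrightarrow> normalized t \<Longrightarrow> u \<in> Poly_Mapping.keys \<rho> \<Longrightarrow> normalized u"
proof (induction arbitrary: u rule: redex.induct)
  case (root x y z j i)
  \<comment> \<open>The six trees that can occur in the relation; in each of them the smallest label
    stays on the left.\<close>
  let ?K = "{Node i (Node j x y) z, Node i x (Node j y z), Node i (Node j x z) y,
    Node j (Node i x y) z, Node j x (Node i y z), Node j (Node i x z) y}"
  have "u \<in> ?K"
  proof (rule ccontr)
    assume "u \<notin> ?K"
    then have "Poly_Mapping.lookup (compat_rel i j (elt x) (elt y) (elt z) :: ctree \<Rightarrow>\<^sub>0 'a) u = 0"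
      by (auto simp: compat_rel_def jac_def bracket_elt lookup_add lookup_minus lookup_single
        when_def simp del: ctree.inject)
    then show False using root.prems(2) by (simp add: in_keys_iff)
  qed
  then show ?case using root by auto
next
  case (left l \<rho> c r)
  from left.prems(2) obtain w where w: "u = Node c w r" "w \<in> Poly_Mapping.keys \<rho>"
    by (auto simp: in_keys_iff lookup_bracket lookup_single when_def split: ctree.splits if_splits)
  moreover have "valency w = valency l"
    using redex_keys[OF left.hyps] w(2) by (auto dest: prec_valency)
  ultimately show ?case using left by simp
next
  case (right r \<rho> c l)
  from right.prems(2) obtain w where w: "u = Node c l w" "w \<in> Poly_Mapping.keys \<rho>"
    by (auto simp: in_keys_iff lookup_bracket lookup_single when_def split: ctree.splits if_splits)
  moreover have "valency w = valency r"
    using redex_keys[OF right.hyps] w(2) by (auto dest: prec_valency)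
  ultimately show ?case using right by simp
qed

text \<open>Rewriting along \<open>prec\<close>: a tree with a redex is congruent to its tail, whose
  trees are smaller, still normalized, and have the same labels and colors.\<close>

lemma normalized_span:
  assumes "normalized t" "distinct (leaves t)" "t \<in> words n"
    and "\<And>u. \<lbrakk>colored_lyndon u; mset (leaves u) = mset (leaves t);
      mset (colors u) = mset (colors t)\<rbrakk> \<Longrightarrow> u \<in> B"
  shows "elt t \<in> pm.span (elt ` B \<union> (lie_ideal n :: (ctree \<Rightarrow>\<^sub>0 'k::field) set))"
  using assms
proof (induction t rule: wf_induct_rule[OF wf_prec])
  case (1 t)
  let ?S = "pm.span (elt ` B \<union> (lie_ideal n :: (ctree \<Rightarrow>\<^sub>0 'k) set))"
  show ?case
  proof (cases "colored_lyndon t")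
    case True
    then show ?thesis using 1(5) by (intro pm.span_base) auto
  next
    case False
    then obtain \<rho> :: "ctree \<Rightarrow>\<^sub>0 'k" where \<rho>: "redex t \<rho>" using exists_redex 1(2,3) by blast
    have "elt u \<in> ?S" if u: "u \<in> Poly_Mapping.keys (elt t - \<rho>)" for u
    proof (rule 1(1))
      have p: "prec u t" using redex_tail[OF \<rho> u] .
      then show "(u, t) \<in> {(u, t). prec u t}" by simp
      from p have m: "mset (leaves u) = mset (leaves t)" "mset (colors u) = mset (colors t)"
        by (auto simp: prec_def)
      have "u \<noteq> t" using p by auto
      then have "u \<in> Poly_Mapping.keys \<rho>"
        using u by (auto simp: in_keys_iff lookup_minus lookup_single when_def split: if_splits)
      then show "normalized u" using redex_normalized[OF \<rho>] 1(2) by blast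
      show "distinct (leaves u)" using m(1) 1(3) mset_eq_imp_distinct_iff by blast
      show "u \<in> words n" using words_cong[OF m] 1(4) by blast
      show "w \<in> B" if "colored_lyndon w" "mset (leaves w) = mset (leaves u)"
        "mset (colors w) = mset (colors u)" for w
        using 1(5) that m by simp
    qed
    then have "elt t - \<rho> \<in> ?S"
      by (subst poly_mapping_eq_sum) (intro pm.span_sum pm.span_scale)
    moreover have "\<rho> \<in> ?S"
      using redex_lie_ideal[OF \<rho> 1(4)] by (intro pm.span_base) auto
    ultimately have "(elt t - \<rho>) + \<rho> \<in> ?S" by (rule pm.span_add)
    then show ?thesis by simp
  qed
qed

lemma labeled_span:
  assumes t: "t \<in> labeled_trees_of_type n \<mu>"
  shows "elt t \<in> pm.span (elt ` Lyn n \<mu> \<union> (lie_ideal n :: (ctree \<Rightarrow>\<^sub>0 'k::field) set))"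
proof -
  let ?S = "pm.span (elt ` Lyn n \<mu> \<union> (lie_ideal n :: (ctree \<Rightarrow>\<^sub>0 'k) set))"
  have w: "t \<in> words n" "distinct (leaves t)"
    using t by (auto simp: labeled_trees_of_type_def labeled_trees_def)
  have "elt (straighten t) \<in> ?S"
  proof (rule normalized_span)
    fix u
    assume u: "colored_lyndon u" "mset (leaves u) = mset (leaves (straighten t))"
      "mset (colors u) = mset (colors (straighten t))"
    have "u \<in> words n" "distinct (leaves u)" "set (leaves u) = set (leaves t)"
      using u w words_cong[OF u(2,3)] mset_eq_imp_distinct_iff[OF u(2)] mset_eq_setD[OF u(2)]
        by auto
    moreover have "count_list (colors u) j = count_list (colors t) j" for j
      using u(3) by (metis count_mset mset_colors_straighten)
    ultimately show "u \<in> Lyn n \<mu>"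
      using t u(1) by (auto simp: Lyn_def labeled_trees_of_type_def labeled_trees_def)
  qed (use w in \<open>simp_all add: normalized_straighten\<close>)
  then have "scal (straighten_sign t) (elt (straighten t)) \<in> ?S" by (rule pm.span_scale)
  moreover have "elt t - scal (straighten_sign t) (elt (straighten t)) \<in> ?S"
    using straighten_lie_ideal[OF w(1)] by (intro pm.span_base) auto
  ultimately have "scal (straighten_sign t) (elt (straighten t))
      + (elt t - scal (straighten_sign t) (elt (straighten t))) \<in> ?S"
    by (rule pm.span_add)
  then show ?thesis by simp
qed

text \<open>Colored Lyndon trees are their own straightening with sign 1, so \<open>signed\<close>
  fixes \<open>x\<close> and places it among the relations. All its trees are irreducible, which
  forces it to be 0.\<close>

lemma Lyn_independent:
  fixes x :: "ctree \<Rightarrow>\<^sub>0 'k::field"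
  assumes "x \<in> lie_ideal n" "Poly_Mapping.keys x \<subseteq> Lyn n \<mu>"
  shows "x = 0"
proof -
  have L: "colored_lyndon t" "normalized t" "distinct (leaves t)" if "t \<in> Poly_Mapping.keys x" for t
    using that assms(2)
    by (auto simp: Lyn_def labeled_trees_of_type_def labeled_trees_def colored_lyndon_normalized)
  have "extend signed x = extend elt x"
    by (intro extend_cong refl) (simp add: signed_def L straighten_normalized)
  also have "\<dots> = x" using extend_of_linear[of "\<lambda>x. x"] by simp
  finally have "x \<in> relations" using signed_lie_ideal[OF assms(1)] by simp
  then show ?thesis
    by (rule relations_irreducible) (use L colored_lyndon_irreducible in blast)
qed

section \<open>Finiteness of the set of colored Lyndon trees\<close>

lemma length_leaves: "length (leaves t) = Suc (length (colors t))"
  by (induction t) auto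

lemma finite_trees:
  assumes "finite A" "finite B"
  shows "finite {t. set (leaves t) \<subseteq> A \<and> set (colors t) \<subseteq> B \<and> length (colors t) < m}"
proof (induction m)
  case (Suc m)
  let ?F = "{t. set (leaves t) \<subseteq> A \<and> set (colors t) \<subseteq> B \<and> length (colors t) < m}"
  have "{t. set (leaves t) \<subseteq> A \<and> set (colors t) \<subseteq> B \<and> length (colors t) < Suc m}
    \<subseteq> Leaf ` A \<union> (\<lambda>(c, l, r). Node c l r) ` (B \<times> ?F \<times> ?F)" (is "?T \<subseteq> _")
  proof
    fix t assume t: "t \<in> ?T"
    show "t \<in> Leaf ` A \<union> (\<lambda>(c, l, r). Node c l r) ` (B \<times> ?F \<times> ?F)"
    proof (cases t)
      case (Node c l r)
      then have "(c, l, r) \<in> B \<times> ?F \<times> ?F" using t by simp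
      then show ?thesis using Node by (intro UnI2 image_eqI[where x = "(c, l, r)"]) simp
    qed (use t in simp)
  qed
  then show ?case
    by (rule finite_subset) (use assms Suc in auto)
qed simp

lemma finite_Lyn:
  assumes "finite {j. \<mu> j \<noteq> 0}"
  shows "finite (Lyn n \<mu>)"
proof -
  have "set (leaves t) \<subseteq> {1..n} \<and> set (colors t) \<subseteq> {j. \<mu> j \<noteq> 0} \<and> length (colors t) < n"
    if t: "t \<in> Lyn n \<mu>" for t
  proof -
    have l: "set (leaves t) = {1..n}" "distinct (leaves t)"
      using t by (auto simp: Lyn_def labeled_trees_of_type_def labeled_trees_def)
    then have "length (leaves t) = n" using distinct_card[of "leaves t"] by simp
    moreover have "\<mu> j \<noteq> 0" if j: "j \<in> set (colors t)" for j
    proof -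
      have "1 \<le> j" "count_list (colors t) j = \<mu> j"
        using t j by (auto simp: Lyn_def labeled_trees_of_type_def labeled_trees_def words_def)
      then show ?thesis using j count_list_0_iff[of "colors t" j] by simp
    qed
    ultimately show ?thesis
      using l(1) length_leaves[of t] by (simp add: subset_eq)
  qed
  then have "Lyn n \<mu> \<subseteq> {t. set (leaves t) \<subseteq> {1..n} \<and> set (colors t) \<subseteq> {j. \<mu> j \<noteq> 0}
    \<and> length (colors t) < n}"
    by blast
  then show ?thesis
    by (rule finite_subset) (rule finite_trees[OF finite_atLeastAtMost assms])
qed

section \<open>The dimension\<close>

lemma lie_class_carrier: "p \<in> carrier (magma_algebra n) \<Longrightarrow> lie_class n p \<in> carrier (free_lie n)"
  unfolding free_lie_def quotient_module_def lie_class_def A_RCOSETS_def' by auto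

lemma lie_class_self: "p \<in> lie_class n p"
  using lie_ideal.zero by (force simp: mem_lie_class)

lemma lie_class_zero_iff: "lie_class n p = \<zero>\<^bsub>free_lie n\<^esub> \<longleftrightarrow> p \<in> lie_ideal n"
proof -
  have zero: "\<zero>\<^bsub>free_lie n\<^esub> = (lie_ideal n :: (ctree \<Rightarrow>\<^sub>0 'a) set)"
    by (simp add: free_lie_def quotient_module_def)
  have "lie_class n 0 = (lie_ideal n :: (ctree \<Rightarrow>\<^sub>0 'a) set)"
    by (auto simp: mem_lie_class)
  then show ?thesis
    unfolding zero using lie_class_self[of p n] lie_class_add_ideal[of p n 0] by auto
qed

lemma lie_class_add: "lie_class n p \<oplus>\<^bsub>free_lie n\<^esub> lie_class n q = lie_class n (p + q)"
proof -
  have "lie_class n p \<oplus>\<^bsub>free_lie n\<^esub> lie_class n q = (\<Union>a\<in>lie_class n p. \<Union>b\<in>lie_class n q. {a + b})"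
    by (simp add: free_lie_def quotient_module_def set_add_def')
  also have "\<dots> = lie_class n (p + q)"
  proof (intro Set.set_eqI iffI)
    fix x assume "x \<in> (\<Union>a\<in>lie_class n p. \<Union>b\<in>lie_class n q. {a + b})"
    then obtain a b where ab: "a \<in> lie_class n p" "b \<in> lie_class n q" "x = a + b" by blast
    then obtain h k where hk: "h \<in> lie_ideal n" "k \<in> lie_ideal n" "a = h + p" "b = k + q"
      unfolding mem_lie_class by blast
    then have "x = (h + k) + (p + q)" using ab by (simp add: add_ac)
    then show "x \<in> lie_class n (p + q)"
      unfolding mem_lie_class using lie_ideal.add[OF hk(1,2)] by blast
  next
    fix x assume "x \<in> lie_class n (p + q)"
    then obtain h where h: "h \<in> lie_ideal n" "x = h + (p + q)" unfolding mem_lie_class by blast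
    have "h + p \<in> lie_class n p" unfolding mem_lie_class using h(1) by blast
    moreover have "x = (h + p) + q" using h(2) by (simp add: add.assoc)
    ultimately show "x \<in> (\<Union>a\<in>lie_class n p. \<Union>b\<in>lie_class n q. {a + b})"
      using lie_class_self[of q n] by blast
  qed
  finally show ?thesis .
qed

lemma lie_class_scal: "c \<odot>\<^bsub>free_lie n\<^esub> lie_class n p = lie_class n (scal c p)"
proof -
  have *: "lie_class n (scal c x) = lie_class n (scal c p)" if x: "x \<in> lie_class n p" for x
  proof -
    obtain h where h: "h \<in> lie_ideal n" "x = h + p" using x unfolding mem_lie_class by blast
    then show ?thesis
      by (simp add: pm.scale_right_distrib lie_class_add_ideal[OF lie_ideal.scal])
  qed
  have "c \<odot>\<^bsub>free_lie n\<^esub> lie_class n p = (\<Union>x\<in>lie_class n p. lie_class n (scal c x))"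
    by (simp add: free_lie_def quotient_module_def flip: lie_class_def)
  also have "\<dots> = lie_class n (scal c p)"
    using * lie_class_self[of p n] by blast
  finally show ?thesis .
qed

theorem theorem4p2:
  fixes n :: nat and \<mu> :: "nat \<Rightarrow> nat"
  assumes "n \<ge> 1" and "\<mu> \<in> WComp (n - 1)"
  shows "vectorspace.dim (class_ring :: 'k::field ring) (Lie n \<mu>) = card (Lyn n \<mu>)"
proof -
  define T where "T = labeled_trees_of_type n \<mu>"
  define w where "w = (lie_word n :: ctree \<Rightarrow> (ctree \<Rightarrow>\<^sub>0 'k) set)"
  let ?V = "free_lie n :: ('k, (ctree \<Rightarrow>\<^sub>0 'k) set) module"
  interpret V: vectorspace "class_ring :: 'k ring" ?V by (rule free_lie_vectorspace)
  have fin: "finite (Lyn n \<mu>)" using assms(2) by (intro finite_Lyn) (simp add: WComp_def)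
  have Lyn_T: "Lyn n \<mu> \<subseteq> T" by (auto simp: Lyn_def T_def)
  have T_words: "t \<in> words n" if "t \<in> T" for t
    using that by (simp add: T_def labeled_trees_of_type_def labeled_trees_def)
  have w: "w t = lie_class n (elt t)" if "t \<in> T" for t
    using lie_word_eq_class[OF T_words[OF that]] by (simp add: w_def)
  have "w t \<in> carrier ?V" if "t \<in> T" for t
    unfolding w[OF that] by (rule lie_class_carrier[OF elt_carrier[OF T_words[OF that]]])
  then have w_carrier: "w ` T \<subseteq> carrier ?V" by blast
  have wL_carrier: "w ` Lyn n \<mu> \<subseteq> carrier ?V" using w_carrier Lyn_T by blast
  have inj: "inj_on w (Lyn n \<mu>)"
  proof
    fix s t assume st: "s \<in> Lyn n \<mu>" "t \<in> Lyn n \<mu>" "w s = w t"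
    then have "lie_class n (elt s) = (lie_class n (elt t) :: (ctree \<Rightarrow>\<^sub>0 'k) set)"
      using w[of s] w[of t] Lyn_T by (simp add: subset_iff)
    then have "elt s \<in> (lie_class n (elt t) :: (ctree \<Rightarrow>\<^sub>0 'k) set)" by (metis lie_class_self)
    then have "elt s - elt t \<in> (lie_ideal n :: (ctree \<Rightarrow>\<^sub>0 'k) set)" by (auto simp: mem_lie_class)
    moreover have "Poly_Mapping.keys (elt s - elt t :: ctree \<Rightarrow>\<^sub>0 'k) \<subseteq> Lyn n \<mu>"
      using st by (auto simp: in_keys_iff lookup_minus lookup_single when_def split: if_splits)
    ultimately have "elt s - elt t = (0 :: ctree \<Rightarrow>\<^sub>0 'k)" by (rule Lyn_independent)
    then have "Poly_Mapping.lookup (elt s :: ctree \<Rightarrow>\<^sub>0 'k) s = Poly_Mapping.lookup (elt t) s"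
      by simp
    then show "s = t" by (auto simp: lookup_single when_def split: if_splits)
  qed
  \<comment> \<open>A combination of classes is the class of the combination of trees. Injectivity
    of \<open>w\<close> permits the passage from a sum over the image to a sum over the
    trees.\<close>
  have lincomb: "V.lincomb a (w ` A) = lie_class n (\<Sum>t\<in>A. scal (a (w t)) (elt t))"
    if "finite A" "A \<subseteq> Lyn n \<mu>" for a A
    using that
  proof (induction A)
    case empty
    have "lie_class n 0 = \<zero>\<^bsub>?V\<^esub>" by (simp add: lie_class_zero_iff lie_ideal.zero)
    then show ?case by (simp add: V.lincomb_def)
  next
    case (insert t A)
    then have t: "t \<in> T" "t \<in> Lyn n \<mu>" "A \<subseteq> Lyn n \<mu>" using Lyn_T by blast+
    have "w t \<notin> w ` A"
    proof
      assume "w t \<in> w ` A"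
      then obtain s where "s \<in> A" "w s = w t" by force
      then show False using inj_onD[OF inj, of s t] t insert(2) by blast
    qed
    moreover have "w ` A \<subseteq> carrier ?V" "w t \<in> carrier ?V" using wL_carrier t by blast+
    ultimately have "V.lincomb a (w ` A \<union> {w t}) = a (w t) \<odot>\<^bsub>?V\<^esub> w t \<oplus>\<^bsub>?V\<^esub> V.lincomb a (w ` A)"
      by (intro V.lincomb_insert finite_imageI insert(1)) simp_all
    also have "\<dots> = a (w t) \<odot>\<^bsub>?V\<^esub> lie_class n (elt t)
        \<oplus>\<^bsub>?V\<^esub> lie_class n (\<Sum>t\<in>A. scal (a (w t)) (elt t))"
      by (simp only: insert(3)[OF t(3)] flip: w[OF t(1)])
    also have "\<dots> = lie_class n (scal (a (w t)) (elt t) + (\<Sum>t\<in>A. scal (a (w t)) (elt t)))"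
      by (simp only: lie_class_scal lie_class_add)
    finally show ?case using insert(1,2) by simp
  qed
  have indpt: "V.lin_indpt (w ` Lyn n \<mu>)"
  proof (rule V.finite_lin_indpt2)
    fix a :: "_ \<Rightarrow> 'k"
    define x where "x = (\<Sum>t\<in>Lyn n \<mu>. scal (a (w t)) (elt t))"
    have lookup: "Poly_Mapping.lookup x s = (if s \<in> Lyn n \<mu> then a (w s) else 0)" for s
    proof -
      have "Poly_Mapping.lookup x s = (\<Sum>t\<in>Lyn n \<mu>. if t = s then a (w t) else 0)"
        unfolding x_def lookup_sum by (intro sum.cong refl) (simp add: lookup_single when_def)
      then show ?thesis using fin by (simp add: sum.delta)
    qed
    assume "V.lincomb a (w ` Lyn n \<mu>) = \<zero>\<^bsub>?V\<^esub>"
    then have "lie_class n x = \<zero>\<^bsub>?V\<^esub>"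
      using lincomb[OF fin order.refl, of a] by (simp only: x_def)
    then have "x \<in> lie_ideal n" unfolding lie_class_zero_iff .
    moreover have "Poly_Mapping.keys x \<subseteq> Lyn n \<mu>"
      using lookup by (simp add: in_keys_iff subset_iff)
    ultimately have "x = 0" by (rule Lyn_independent)
    then have "a (w s) = 0" if "s \<in> Lyn n \<mu>" for s using lookup[of s] that by simp
    then show "\<forall>v\<in>w ` Lyn n \<mu>. a v = \<zero>\<^bsub>class_ring\<^esub>" by simp
  qed (rule finite_imageI[OF fin], rule wL_carrier)
  have sub: "submodule class_ring (V.span (w ` Lyn n \<mu>)) ?V"
    by (rule V.span_is_submodule[OF wL_carrier])
  interpret S: LinearCombinations.submodule "class_ring :: 'k ring" "V.span (w ` Lyn n \<mu>)" ?V
    by (rule sub)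
  \<comment> \<open>The class map is linear and kills the ideal, so spanning modulo the ideal
    becomes spanning in the quotient.\<close>
  have span: "lie_class n p \<in> V.span (w ` Lyn n \<mu>)"
    if "p \<in> pm.span (elt ` Lyn n \<mu> \<union> lie_ideal n)" for p :: "ctree \<Rightarrow>\<^sub>0 'k"
    using that
  proof (induction rule: pm.span_induct_alt)
    case base
    have "lie_class n 0 = \<zero>\<^bsub>?V\<^esub>" by (simp add: lie_class_zero_iff lie_ideal.zero)
    then show ?case by simp
  next
    case (step c x y)
    have "lie_class n x \<in> V.span (w ` Lyn n \<mu>)"
    proof (cases "x \<in> lie_ideal n")
      case True
      then show ?thesis using lie_class_zero_iff[of n x] by simp
    next
      case False
      then obtain t where t: "t \<in> Lyn n \<mu>" "x = elt t" using step(1) by blast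
      then have "lie_class n x = w t" using w[of t] Lyn_T by (simp add: subset_iff)
      then show ?thesis using t(1) V.in_own_span[OF wL_carrier] by (simp add: image_subset_iff)
    qed
    then have "c \<odot>\<^bsub>?V\<^esub> lie_class n x \<oplus>\<^bsub>?V\<^esub> lie_class n y \<in> V.span (w ` Lyn n \<mu>)"
      using step(2) by (intro S.m_closed S.smult_closed) simp_all
    then show ?case by (simp add: lie_class_scal lie_class_add)
  qed
  have "w ` T \<subseteq> V.span (w ` Lyn n \<mu>)"
  proof (rule image_subsetI)
    fix t assume "t \<in> T"
    then show "w t \<in> V.span (w ` Lyn n \<mu>)" using span[OF labeled_span] w[of t] by (simp add: T_def)
  qed
  then have "V.span (w ` T) = V.span (w ` Lyn n \<mu>)"
    using V.span_is_subset[OF _ sub] V.span_is_monotone[of "w ` Lyn n \<mu>" "w ` T"] Lyn_T by blast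
  then have Lie: "Lie n \<mu> = ?V\<lparr>carrier := V.span (w ` Lyn n \<mu>)\<rparr>"
    by (simp add: Lie_def w_def T_def)
  have vs: "vectorspace (class_ring :: 'k ring) (Lie n \<mu>)"
    unfolding Lie by (rule V.subspace_is_vs[OF V.span_is_subspace[OF wL_carrier]])
  interpret L: vectorspace "class_ring :: 'k ring" "Lie n \<mu>" by (rule vs)
  have own: "w ` Lyn n \<mu> \<subseteq> V.span (w ` Lyn n \<mu>)" by (rule V.in_own_span[OF wL_carrier])
  have "L.basis (w ` Lyn n \<mu>)"
    \<comment> \<open>Span and independence, established in the whole free algebra, are transferred
      to the subspace as a vector space of its own.\<close>
    unfolding L.basis_def
    using V.span_li_not_depend[OF own sub] indpt own by (simp add: Lie)
  then have "L.dim = card (w ` Lyn n \<mu>)" using fin by (intro L.dim_basis) auto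
  also have "\<dots> = card (Lyn n \<mu>)" by (rule card_image[OF inj])
  finally show ?thesis .
qed

end
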